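(* For every constant $\varepsilon>0$ there is a deterministic algorithm that, given an instance of \textsc{co-$\ell$-Median} (uncapacitated), outputs a feasible solution whose connection cost is at most $(1+\varepsilon)$ times the optimum, and runs in time $2^{\mathcal{O}(\ell\log(\ell/\varepsilon))}\cdot n^{\mathcal{O}(1)}$, where $n$ is the size of the instance.
   Context: \textsc{co-$\ell$-Median} (uncapacitated): the input is a finite set of facilities $F$, a finite set of clients $C$, a metric $d$ on $F\cup C$ (symmetric, $d(x,x)=0$, triangle inequality), and an integer $\ell$ (the parameter). A solution is a set of open facilities of size at most $|F|-\ell$ (equivalently, a set $S\subseteq F$ of at least $\ell$ closed facilities) together with an assignment $\phi$ of each client to an open facility; the goal is to minimize $\sum_{c\in C} d(c,\phi(c))$. There are no capacity constraints, so each client can be assigned to its nearest open facility. *)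

theory Defs
  imports Complex_Main "HOL-Library.Log_Nat"
begin

(* The machine model: a first-order, call-by-value functional language on binary trees
   whose leaves are rational numbers.  Each evaluation step costs one unit of time.

   The only arithmetic is addition, subtraction and comparison; there is deliberately
   neither multiplication nor division.  After t steps every leaf is an integer linear
   combination of the leaves of the input and the constants of the program, with
   coefficients of absolute value at most 2^t.  Over the common denominator of inputs and
   constants it is thus an integer whose bit length is at most t plus a polynomial in the
   input size, and with trees kept as pointers each step takes polynomial time on a Turing
   machine.  So running times here and on Turing machines are polynomially related. *)

datatype val = Leaf rat | Node val val

datatype expr =
    Var nat                        (* position in the current environment *)
  | Const rat
  | Add expr expr
  | Sub expr expr
  | MkNode expr expr
  | Left expr
  | Right expr
  | IfLess expr expr expr expr     (* if e1 < e2 then e3 else e4 *)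
  | IfNode expr expr expr          (* if e1 is a Node then e2 else e3 *)
  | LetIn expr expr                (* the value of e1 becomes Var 0 in e2 *)
  | Call nat "expr list"

(* The bodies of finitely many mutually recursive functions. *)
type_synonym program = "expr list"

(* eval P env e v t: the expression e evaluates to v in exactly t steps.  Ill-formed
   operations (unbound variables, arithmetic on nodes, projections of leaves) are stuck. *)
inductive eval :: "program \<Rightarrow> val list \<Rightarrow> expr \<Rightarrow> val \<Rightarrow> nat \<Rightarrow> bool"
  and evals :: "program \<Rightarrow> val list \<Rightarrow> expr list \<Rightarrow> val list \<Rightarrow> nat \<Rightarrow> bool"
  for P :: program
where
  Var: "i < length env \<Longrightarrow> eval P env (Var i) (env ! i) 1"
| Const: "eval P env (Const q) (Leaf q) 1"
| Add: "eval P env e1 (Leaf p) t1 \<Longrightarrow> eval P env e2 (Leaf q) t2 \<Longrightarrow>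
    eval P env (Add e1 e2) (Leaf (p + q)) (1 + t1 + t2)"
| Sub: "eval P env e1 (Leaf p) t1 \<Longrightarrow> eval P env e2 (Leaf q) t2 \<Longrightarrow>
    eval P env (Sub e1 e2) (Leaf (p - q)) (1 + t1 + t2)"
| MkNode: "eval P env e1 v1 t1 \<Longrightarrow> eval P env e2 v2 t2 \<Longrightarrow>
    eval P env (MkNode e1 e2) (Node v1 v2) (1 + t1 + t2)"
| Left: "eval P env e (Node v1 v2) t \<Longrightarrow> eval P env (Left e) v1 (1 + t)"
| Right: "eval P env e (Node v1 v2) t \<Longrightarrow> eval P env (Right e) v2 (1 + t)"
| IfLess: "eval P env e1 (Leaf p) t1 \<Longrightarrow> eval P env e2 (Leaf q) t2 \<Longrightarrow>
    eval P env (if p < q then e3 else e4) v t3 \<Longrightarrow>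
    eval P env (IfLess e1 e2 e3 e4) v (1 + t1 + t2 + t3)"
| IfNode: "eval P env e1 u t1 \<Longrightarrow>
    eval P env (case u of Node _ _ \<Rightarrow> e2 | Leaf _ \<Rightarrow> e3) v t2 \<Longrightarrow>
    eval P env (IfNode e1 e2 e3) v (1 + t1 + t2)"
| LetIn: "eval P env e1 u t1 \<Longrightarrow> eval P (u # env) e2 v t2 \<Longrightarrow>
    eval P env (LetIn e1 e2) v (1 + t1 + t2)"
| Call: "evals P env es vs t1 \<Longrightarrow> f < length P \<Longrightarrow> eval P vs (P ! f) v t2 \<Longrightarrow>
    eval P env (Call f es) v (1 + t1 + t2)"
| Nil: "evals P env [] [] 0"
| Cons: "eval P env e v t1 \<Longrightarrow> evals P env es vs t2 \<Longrightarrow>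
    evals P env (e # es) (v # vs) (t1 + t2)"

inductive_cases eval_VarE: "eval P env (Var i) v t"
inductive_cases eval_ConstE: "eval P env (Const q) v t"
inductive_cases eval_AddE: "eval P env (Add e1 e2) v t"
inductive_cases eval_SubE: "eval P env (Sub e1 e2) v t"
inductive_cases eval_MkNodeE: "eval P env (MkNode e1 e2) v t"
inductive_cases eval_LeftE: "eval P env (Left e) v t"
inductive_cases eval_RightE: "eval P env (Right e) v t"
inductive_cases eval_IfLessE: "eval P env (IfLess e1 e2 e3 e4) v t"
inductive_cases eval_IfNodeE: "eval P env (IfNode e1 e2 e3) v t"
inductive_cases eval_LetInE: "eval P env (LetIn e1 e2) v t"
inductive_cases eval_CallE: "eval P env (Call f es) v t"
inductive_cases evals_NilE: "evals P env [] vs t"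
inductive_cases evals_ConsE: "evals P env (e # es) vs t"

lemma eval_deterministic:
  "eval P env e v t \<Longrightarrow> eval P env e v' t' \<Longrightarrow> v' = v \<and> t' = t"
  "evals P env es vs t \<Longrightarrow> evals P env es vs' t' \<Longrightarrow> vs' = vs \<and> t' = t"
proof (induction arbitrary: v' t' and vs' t' rule: eval_evals.inducts)
  case Var then show ?case by (auto elim: eval_VarE)
next
  case Const then show ?case by (auto elim: eval_ConstE)
next
  case Add from Add.prems show ?case by (rule eval_AddE) (auto dest!: Add.IH(2,4))
next
  case Sub from Sub.prems show ?case by (rule eval_SubE) (auto dest!: Sub.IH(2,4))
next
  case MkNode from MkNode.prems show ?case by (rule eval_MkNodeE) (auto dest!: MkNode.IH(2,4))
next
  case Left from Left.prems show ?case by (rule eval_LeftE) (auto dest!: Left.IH(2))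
next
  case Right from Right.prems show ?case by (rule eval_RightE) (auto dest!: Right.IH(2))
next
  case IfLess from IfLess.prems show ?case
    by (rule eval_IfLessE) (drule IfLess.IH(2), drule IfLess.IH(4), clarify, drule IfLess.IH(6), simp)
next
  case IfNode from IfNode.prems show ?case
    by (rule eval_IfNodeE) (drule IfNode.IH(2), clarify, drule IfNode.IH(4), simp)
next
  case LetIn from LetIn.prems show ?case
    by (rule eval_LetInE) (drule LetIn.IH(2), clarify, drule LetIn.IH(4), simp)
next
  case Call from Call.prems show ?case
    by (rule eval_CallE) (drule Call.IH(2), clarify, drule Call.IH(5), simp)
next
  case Nil then show ?case by (auto elim: evals_NilE)
next
  case Cons from Cons.prems show ?case by (rule evals_ConsE) (auto dest!: Cons.IH(2,4))
qed

(* On input x the program P halts after exactly t steps with output y. *)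
definition runs :: "program \<Rightarrow> val \<Rightarrow> val \<Rightarrow> nat \<Rightarrow> bool" where
  "runs P x y t \<longleftrightarrow> eval P [x] (Call 0 [Var 0]) y t"

(* One unit per tree node, plus the binary lengths of all numerators and denominators. *)
fun val_size :: "val \<Rightarrow> nat" where
  "val_size (Leaf q) =
     (case quotient_of q of (a, b) \<Rightarrow> 1 + floorlog 2 (nat \<bar>a\<bar>) + floorlog 2 (nat b))"
| "val_size (Node u v) = 1 + val_size u + val_size v"

fun list_val :: "val list \<Rightarrow> val" where
  "list_val [] = Leaf 0"
| "list_val (v # vs) = Node v (list_val vs)"

definition nat_val :: "nat \<Rightarrow> val" where
  "nat_val n = Leaf (of_nat n)"

(* Points are named by natural numbers.  Distances are rational so that an instance is a
   finite object; facilities and clients may share points. *)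
record co_median =
  facilities :: "nat set"
  clients :: "nat set"
  dist_fun :: "nat \<Rightarrow> nat \<Rightarrow> rat"
  param :: nat

definition points :: "co_median \<Rightarrow> nat set" where
  "points I = facilities I \<union> clients I"

(* Nonnegativity of distances follows; distinct points may have distance 0. *)
definition valid_instance :: "co_median \<Rightarrow> bool" where
  "valid_instance I \<longleftrightarrow>
     finite (facilities I) \<and> finite (clients I) \<and>
     (\<forall>x\<in>points I. dist_fun I x x = 0) \<and>
     (\<forall>x\<in>points I. \<forall>y\<in>points I. dist_fun I x y = dist_fun I y x) \<and>
     (\<forall>x\<in>points I. \<forall>y\<in>points I. \<forall>z\<in>points I.
        dist_fun I x z \<le> dist_fun I x y + dist_fun I y z)"

(* Open facilities and assignment of the clients. *)
type_synonym solution = "nat set \<times> (nat \<Rightarrow> nat)"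

(* The cardinality condition is |A| \<le> |F| - l, free of truncated subtraction. *)
definition feasible :: "co_median \<Rightarrow> solution \<Rightarrow> bool" where
  "feasible I = (\<lambda>(A, \<phi>).
     A \<subseteq> facilities I \<and> card A + param I \<le> card (facilities I) \<and>
     (\<forall>c\<in>clients I. \<phi> c \<in> A))"

definition cost :: "co_median \<Rightarrow> solution \<Rightarrow> real" where
  "cost I = (\<lambda>(A, \<phi>). \<Sum>c\<in>clients I. of_rat (dist_fun I c (\<phi> c)))"

definition opt :: "co_median \<Rightarrow> real" where
  "opt I = (INF s \<in> {s. feasible I s}. cost I s)"

definition set_val :: "nat set \<Rightarrow> val" where
  "set_val X = list_val (map nat_val (sorted_list_of_set X))"

definition dist_val :: "co_median \<Rightarrow> val" where
  "dist_val I =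
     (let xs = sorted_list_of_set (points I)
      in list_val (map (\<lambda>(x, y). Node (nat_val x) (Node (nat_val y) (Leaf (dist_fun I x y))))
           (List.product xs xs)))"

definition instance_val :: "co_median \<Rightarrow> val" where
  "instance_val I =
     Node (nat_val (param I))
       (Node (set_val (facilities I)) (Node (set_val (clients I)) (dist_val I)))"

(* The open facilities, and the graph of the assignment restricted to the clients. *)
definition solution_val :: "co_median \<Rightarrow> solution \<Rightarrow> val" where
  "solution_val I = (\<lambda>(A, \<phi>).
     Node (set_val A)
       (list_val (map (\<lambda>c. Node (nat_val c) (nat_val (\<phi> c)))
          (sorted_list_of_set (clients I)))))"

definition instance_size :: "co_median \<Rightarrow> nat" where
  "instance_size I = val_size (instance_val I)"

(* l * log (l / eps), as written whenever l \<ge> 2 and eps \<le> 1.  The max keeps the logarithm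
   positive when l / eps < 2.  For a constant eps > 1 the min is an eps-dependent constant
   factor as l grows; it allows the constants of the O-notation to be uniform in eps. *)
definition time_exponent :: "nat \<Rightarrow> real \<Rightarrow> real" where
  "time_exponent l \<epsilon> = real l * log 2 (max 2 (real l / min 1 \<epsilon>))"

end

theory Submission
  imports Defs
begin

text \<open>
  Closing k further facilities R costs at least the sum of their individual closing prices. If T
  consists of poly(l / e) facilities of smallest price and R misses T, then a conflict-free subset
  of T of size k can replace R at the loss of a factor 1 + e / (2 l). Hence some near-optimal
  solution closes a facility of T, and the algorithm branches over T, with the prices recomputed
  after every closure. Over l levels the loss is (1 + e / (2 l)) ^ l, at most 1 + e, and the search
  tree has poly(l / e) ^ l leaves.
\<close>

subsection \<open>Exchanging closed facilities\<close>

text \<open>Individual prices can badly underestimate a joint closure: they let a client move to its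
  second choice even when that facility closes too. For a conflict-free set of size \<open>k\<close>
  the resulting error is at most \<open>2 * k * \<delta>\<close> times the estimated full cost, that
  is, \<open>service_cost A\<close> plus the prices; by the choice of T this estimate is at most the
  cost after closing R. With \<open>\<delta>\<close> equal to e / (4 l^2) and k at most l, this is
  the loss allowed per level. The same \<open>\<delta>\<close> determines the width. At most about 1
  / \<open>\<delta>\<close> facilities can each account for more than a \<open>\<delta>\<close>
  share of one weight, so outdegrees are of order l^2 / e, and T needs of order l^3 / e elements.
  The machine neither multiplies nor divides. The width is therefore l^3 times a program constant
  \<open>b\<close> of order 1 / e, obtained by repeated addition, and the accuracy enters the
  program only through \<open>b\<close>.\<close>

text \<open>Only outdegrees are bounded, and single indegrees may be large; but both have the same
  average, so some \<open>g\<close> has indegree at most \<open>D\<close>. Picking it and discarding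
  it with all its in- and out-neighbours costs at most \<open>2 * D + 1\<close> elements of
  \<open>T\<close> per element of \<open>R\<close>.\<close>

lemma independent_subset:
  fixes E :: "'a rel"
  assumes "finite T" and "\<And>g. g \<in> T \<Longrightarrow> card {g' \<in> T. (g, g') \<in> E} \<le> D"
    and "k * (2 * D + 1) \<le> card T"
  shows "\<exists>R \<subseteq> T. card R = k \<and> (\<forall>g\<in>R. \<forall>g'\<in>R. g \<noteq> g' \<longrightarrow> (g, g') \<notin> E)"
  using assms
proof (induction k arbitrary: T)
  case 0
  then show ?case by (intro exI[of _ "{}"]) auto
next
  case (Suc k)
  have ne: "T \<noteq> {}" using Suc.prems(3) by auto
  have "\<exists>g\<in>T. card {g' \<in> T. (g', g) \<in> E} \<le> D"
  proof (rule ccontr)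
    assume "\<not> ?thesis"
    then have "(\<Sum>g\<in>T. D) < (\<Sum>g\<in>T. card {g' \<in> T. (g', g) \<in> E})"
      using Suc.prems(1) ne by (intro sum_strict_mono) auto
    also have "\<dots> = (\<Sum>g\<in>T. card {g' \<in> T. (g, g') \<in> E})"
    proof -
      have card_eq: "card {x\<in>T. Q x} = (\<Sum>x\<in>T. if Q x then 1 else 0)" for Q
        using Suc.prems(1) by (simp add: sum.If_cases Int_def)
      show ?thesis unfolding card_eq by (rule sum.swap)
    qed
    also have "\<dots> \<le> (\<Sum>g\<in>T. D)"
      by (intro sum_mono Suc.prems(2))
    finally show False by simp
  qed
  then obtain g where g: "g \<in> T" and ing: "card {g' \<in> T. (g', g) \<in> E} \<le> D" by blast
  define N where "N = insert g ({g' \<in> T. (g', g) \<in> E} \<union> {g' \<in> T. (g, g') \<in> E})"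
  have "card N \<le> Suc (card ({g' \<in> T. (g', g) \<in> E} \<union> {g' \<in> T. (g, g') \<in> E}))"
    unfolding N_def by (simp add: card_insert_le_m1 Suc.prems(1) card_insert_if)
  also have "\<dots> \<le> Suc (card {g' \<in> T. (g', g) \<in> E} + card {g' \<in> T. (g, g') \<in> E})"
    using card_Un_le by simp
  also have "\<dots> \<le> 2 * D + 1" using ing Suc.prems(2)[OF g] by simp
  finally have cN: "card N \<le> 2 * D + 1" .
  have NT: "N \<subseteq> T" using g by (auto simp: N_def)
  have fN: "finite N" using NT Suc.prems(1) finite_subset by blast
  have "card (T - N) = card T - card N" using fN NT by (rule card_Diff_subset)
  then have cT: "k * (2 * D + 1) \<le> card (T - N)" using cN Suc.prems(3) by simp
  have "card {g' \<in> T - N. (h, g') \<in> E} \<le> D" if "h \<in> T - N" for h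
  proof -
    have "card {g' \<in> T - N. (h, g') \<in> E} \<le> card {g' \<in> T. (h, g') \<in> E}"
      using Suc.prems(1) by (intro card_mono) auto
    with Suc.prems(2)[of h] that show ?thesis by simp
  qed
  from Suc.IH[OF _ this cT] Suc.prems(1) obtain R where R: "R \<subseteq> T - N" "card R = k"
    "\<forall>h\<in>R. \<forall>g'\<in>R. h \<noteq> g' \<longrightarrow> (h, g') \<notin> E" by auto
  have "finite R" using R(1) Suc.prems(1) by (meson finite_Diff finite_subset)
  moreover have "g \<notin> R" using R(1) by (auto simp: N_def)
  ultimately have "card (insert g R) = Suc k" using R(2) by simp
  moreover have "insert g R \<subseteq> T" using R(1) g by auto
  moreover have "\<forall>h\<in>insert g R. \<forall>g'\<in>insert g R. h \<noteq> g' \<longrightarrow> (h, g') \<notin> E"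
    using R(1,3) by (auto simp: N_def)
  ultimately show ?case by blast
qed

locale finite_metric =
  fixes X :: "'a set" and C :: "'a set" and d :: "'a \<Rightarrow> 'a \<Rightarrow> real"
  assumes finite_clients: "finite C" and clients_sub: "C \<subseteq> X"
    and dist_refl: "x \<in> X \<Longrightarrow> d x x = 0"
    and dist_sym: "x \<in> X \<Longrightarrow> y \<in> X \<Longrightarrow> d x y = d y x"
    and dist_triangle: "x \<in> X \<Longrightarrow> y \<in> X \<Longrightarrow> z \<in> X \<Longrightarrow> d x z \<le> d x y + d y z"
begin

lemma dist_nonneg: "x \<in> X \<Longrightarrow> y \<in> X \<Longrightarrow> 0 \<le> d x y"
  using dist_triangle[of x y x] dist_refl[of x] dist_sym[of x y] by simp

text \<open>\<open>Min\<close> says nothing useful about the empty set, so the facts about costs ask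
  for an open facility or for an empty set of clients.\<close>

definition serve :: "'a set \<Rightarrow> 'a \<Rightarrow> real" where
  "serve A c = Min (d c ` A)"

definition service_cost :: "'a set \<Rightarrow> real" where
  "service_cost A = (\<Sum>c\<in>C. serve A c)"

lemma serve_le: "finite A \<Longrightarrow> a \<in> A \<Longrightarrow> serve A c \<le> d c a"
  by (simp add: serve_def)

lemma serve_attained:
  assumes "finite A" "A \<noteq> {}" shows "\<exists>a\<in>A. d c a = serve A c"
proof -
  have "serve A c \<in> d c ` A" unfolding serve_def using assms by (intro Min_in) auto
  then show ?thesis by auto
qed

lemma serve_antimono:
  "finite B \<Longrightarrow> A \<subseteq> B \<Longrightarrow> A \<noteq> {} \<Longrightarrow> serve B c \<le> serve A c"
  unfolding serve_def by (intro Min_antimono) auto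

lemma service_cost_antimono: "finite B \<Longrightarrow> A \<subseteq> B \<Longrightarrow> A \<noteq> {} \<Longrightarrow> service_cost B \<le> service_cost A"
  unfolding service_cost_def by (intro sum_mono serve_antimono)

lemma service_cost_nonneg: "finite A \<Longrightarrow> A \<noteq> {} \<or> C = {} \<Longrightarrow> A \<subseteq> X \<Longrightarrow> 0 \<le> service_cost A"
proof (cases "C = {}")
  case False
  assume A: "finite A" "A \<noteq> {} \<or> C = {}" "A \<subseteq> X"
  show ?thesis unfolding service_cost_def
  proof (rule sum_nonneg)
    fix c assume "c \<in> C"
    obtain a where "a \<in> A" "d c a = serve A c" using serve_attained A False by blast
    then show "0 \<le> serve A c" using dist_nonneg[of c a] A \<open>c \<in> C\<close> clients_sub by auto
  qed
next
  case True
  show ?thesis unfolding service_cost_def using True by simp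
qed

text \<open>Let p c and s c be the nearest and second nearest facilities of a client, and let W g be
  the total distance d c (s c) over the clients with p c = g. A set R' of facilities can be closed
  at about the sum of the individual prices if no n g with g in R' (the facility nearest to g) lies
  in R' and only a small share of each W g comes from clients with s c in R': a client losing both
  p c and s c moves to n (p c), at distance at most 3 d c (s c). These conflicts form a digraph of
  small outdegree, so T contains a conflict-free R' of size k. Closing R costs at least the sum of
  the individual prices.\<close>

lemma exchange:
  assumes A: "finite A" "A \<subseteq> X" and T: "T \<subseteq> A" and R: "R \<subseteq> A" "card R = k" "R \<noteq> A \<or> C = {}"
    and disj: "R \<inter> T = {}" and k: "0 < k"
    and cheap: "\<And>g h. g \<in> T \<Longrightarrow> h \<in> R \<Longrightarrow> service_cost (A - {g}) \<le> service_cost (A - {h})"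
    and \<delta>: "0 < \<delta>" "1 \<le> \<delta> * real D" and cardT: "k * (2 * D + 3) \<le> card T"
  shows "\<exists>R' \<subseteq> T. card R' = k \<and> service_cost (A - R') \<le> (1 + 2 * real k * \<delta>) * service_cost (A - R)"
proof (cases "C = {}")
  case True
  \<comment> \<open>Without clients \<open>R\<close> may be all of \<open>A\<close>, leaving no
    second facility to speak of; every cost is then an empty sum.\<close>
  have "k \<le> k * (2 * D + 3)" by simp
  with cardT have "k \<le> card T" by linarith
  then obtain R' where "R' \<subseteq> T" "card R' = k" by (rule obtain_subset_with_card_n)
  moreover have "service_cost B = 0" for B unfolding service_cost_def using True by simp
  ultimately show ?thesis by auto
next
  case False
  have fin: "finite T" "finite R" using A T R finite_subset by blast+
  have RA: "R \<subset> A" using R False by auto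
  have Rne: "R \<noteq> {}" using R k by auto
  \<comment> \<open>\<open>A\<close> has an element in \<open>R\<close> and one outside, hence at
    least two: second nearest facilities exist.\<close>
  have ne: "A - {g} \<noteq> {}" for g using RA Rne disj by blast
  have Ane: "A \<noteq> {}" using RA by auto
  have inX: "a \<in> X" if "a \<in> A" for a using that A by auto
  have cX: "c \<in> X" if "c \<in> C" for c using that clients_sub by auto
  obtain p where p: "\<And>c. p c \<in> A" "\<And>c. d c (p c) = serve A c"
    using serve_attained[OF A(1) Ane] by metis
  have "\<exists>a \<in> A - {p c}. d c a = serve (A - {p c}) c" for c
    using ne A(1) by (intro serve_attained) auto
  then obtain s where s: "\<And>c. s c \<in> A - {p c}" "\<And>c. d c (s c) = serve (A - {p c}) c"
    by metis
  have "\<exists>a \<in> A - {g}. d g a = serve (A - {g}) g" for g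
    using ne A(1) by (intro serve_attained) auto
  then obtain n where n: "\<And>g. n g \<in> A - {g}" "\<And>g. d g (n g) = serve (A - {g}) g"
    by metis
  define v where "v c = d c (s c)" for c
  have pv: "d c (p c) \<le> v c" for c
    using s(1)[of c] A(1) p(2) by (simp add: v_def serve_le)
  have p0: "0 \<le> d c (p c)" "0 \<le> v c" if "c \<in> C" for c
    using that cX inX p(1) s(1) by (auto simp: v_def intro!: dist_nonneg)
  define Cl where "Cl g = {c \<in> C. p c = g}" for g
  define W where "W g = (\<Sum>c\<in>Cl g. v c)" for g
  \<comment> \<open>The share of \<open>W g\<close> due to clients whose second choice is
    \<open>g'\<close>. For fixed \<open>g\<close> these shares come from disjoint sets of
    clients.\<close>
  define J where "J g g' = (\<Sum>c\<in>{c \<in> Cl g. s c = g'}. v c)" for g g'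
  have fCl: "finite (Cl g)" for g using finite_clients by (simp add: Cl_def)
  have W0: "0 \<le> W g" for g unfolding W_def by (intro sum_nonneg) (auto simp: Cl_def p0)
  have J0: "0 \<le> J g g'" for g g' unfolding J_def by (intro sum_nonneg) (auto simp: Cl_def p0)
  have sumJ: "(\<Sum>g'\<in>B. J g g') = (\<Sum>c\<in>{c \<in> Cl g. s c \<in> B}. v c)" if "finite B" for g B
  proof -
    have "(\<Sum>g'\<in>B. J g g') = (\<Sum>g'\<in>B. \<Sum>c\<in>{c \<in> {c \<in> Cl g. s c \<in> B}. s c = g'}. v c)"
      unfolding J_def by (intro sum.cong) auto
    also have "\<dots> = (\<Sum>c\<in>{c \<in> Cl g. s c \<in> B}. v c)"
      using that fCl by (intro sum.group) auto
    finally show ?thesis .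
  qed
  have sumJW: "(\<Sum>g'\<in>B. J g g') \<le> W g" if "finite B" for g B
    unfolding sumJ[OF that] W_def
    by (intro sum_mono2 fCl) (auto simp: Cl_def p0)
  have serve_del: "serve (A - {g}) c = (if p c = g then v c else serve A c)" for g c
  proof (cases "p c = g")
    case True then show ?thesis using s(2)[of c] by (simp add: v_def)
  next
    case False
    have "serve (A - {g}) c \<le> serve A c"
      unfolding p(2)[symmetric] using A(1) p(1)[of c] False by (intro serve_le) auto
    moreover have "serve A c \<le> serve (A - {g}) c"
      using A(1) ne by (intro serve_antimono) auto
    ultimately show ?thesis using False by simp
  qed
  have gain: "service_cost (A - {g}) - service_cost A = (\<Sum>c\<in>Cl g. v c - d c (p c))" for g
  proof -
    have "service_cost (A - {g}) - service_cost A = (\<Sum>c\<in>C. if p c = g then v c - d c (p c) else 0)"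
      unfolding service_cost_def sum_subtractf[symmetric] serve_del p(2) by (intro sum.cong) auto
    also have "\<dots> = (\<Sum>c\<in>Cl g. v c - d c (p c))"
      unfolding Cl_def using finite_clients by (rule sum.inter_filter[symmetric])
    finally show ?thesis .
  qed
  have gains: "(\<Sum>g\<in>B. service_cost (A - {g}) - service_cost A)
      = (\<Sum>c\<in>{c \<in> C. p c \<in> B}. v c - d c (p c))" if "finite B" for B
  proof -
    have "(\<Sum>g\<in>B. service_cost (A - {g}) - service_cost A)
        = (\<Sum>g\<in>B. \<Sum>c\<in>{c \<in> {c \<in> C. p c \<in> B}. p c = g}. v c - d c (p c))"
      unfolding gain by (intro sum.cong) (auto simp: Cl_def)
    also have "\<dots> = (\<Sum>c\<in>{c \<in> C. p c \<in> B}. v c - d c (p c))"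
      using that finite_clients by (intro sum.group) auto
    finally show ?thesis .
  qed
  \<comment> \<open>Adding up prices amounts to pretending that every client losing its nearest
    facility still finds its second nearest one open.\<close>
  have service_cost_plus: "service_cost A + (\<Sum>g\<in>B. service_cost (A - {g}) - service_cost A)
      = (\<Sum>c\<in>C. if p c \<in> B then v c else d c (p c))" if "finite B" for B
    unfolding gains[OF that] unfolding service_cost_def p(2)[symmetric] sum.inter_filter[OF finite_clients]
      sum.distrib[symmetric]
    by (intro sum.cong) auto

  define E where "E = {(g, g'). g' = n g \<or> \<delta> * W g < J g g'}"
  \<comment> \<open>One arc leads to \<open>n g\<close>. More than \<open>D\<close> others would
    have shares adding up to more than \<open>D * \<delta> * W g\<close>, hence exceeding
    \<open>W g\<close>. Thus \<open>independent_subset\<close> consumes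
    \<open>2 * (D + 1) + 1 = 2 * D + 3\<close> elements per pick.\<close>
  have "card {g' \<in> T. (g, g') \<in> E} \<le> D + 1" for g
  proof -
    let ?H = "{g' \<in> T. \<delta> * W g < J g g'}"
    have "card ?H \<le> D"
    proof (rule ccontr)
      assume "\<not> ?thesis"
      then have gt: "D < card ?H" by simp
      then have "?H \<noteq> {}" by force
      then have "(\<Sum>g'\<in>?H. \<delta> * W g) < (\<Sum>g'\<in>?H. J g g')"
        using fin(1) by (intro sum_strict_mono) auto
      also have "\<dots> \<le> W g" using fin(1) by (intro sumJW) auto
      finally have "real (card ?H) * \<delta> * W g < W g" by (simp add: mult.assoc)
      moreover have "1 \<le> real (card ?H) * \<delta>"
      proof -
        have "\<delta> * real D \<le> \<delta> * real (card ?H)" using gt \<delta>(1) by (intro mult_left_mono) auto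
        then show ?thesis using \<delta>(2) by (simp add: mult.commute)
      qed
      then have "1 * W g \<le> real (card ?H) * \<delta> * W g" using W0 by (intro mult_right_mono)
      ultimately show False by simp
    qed
    moreover have "card {g' \<in> T. (g, g') \<in> E} \<le> card (insert (n g) ?H)"
      using fin(1) by (intro card_mono) (auto simp: E_def)
    moreover have "card (insert (n g) ?H) \<le> Suc (card ?H)"
      using fin(1) by (simp add: card_insert_if)
    ultimately show ?thesis by linarith
  qed
  moreover have "k * (2 * (D + 1) + 1) \<le> card T" using cardT by (simp add: algebra_simps)
  ultimately obtain R' where R': "R' \<subseteq> T" "card R' = k"
    "\<And>g g'. g \<in> R' \<Longrightarrow> g' \<in> R' \<Longrightarrow> g \<noteq> g' \<Longrightarrow> (g, g') \<notin> E"
    using independent_subset[OF fin(1), of E "D + 1" k] by blast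
  have fR': "finite R'" using R'(1) fin(1) finite_subset by blast
  define Z where "Z = service_cost A + (\<Sum>g\<in>R'. service_cost (A - {g}) - service_cost A)"

  \<comment> \<open>Both sets have \<open>k\<close> elements, and the least price \<open>m\<close>
    in \<open>R\<close> separates their prices.\<close>
  have "(\<Sum>g\<in>R'. service_cost (A - {g}) - service_cost A) \<le> (\<Sum>h\<in>R. service_cost (A - {h}) - service_cost A)"
  proof -
    define m where "m = Min ((\<lambda>h. service_cost (A - {h}) - service_cost A) ` R)"
    have m1: "m \<le> service_cost (A - {h}) - service_cost A" if "h \<in> R" for h
      unfolding m_def using that fin(2) by (intro Min_le) auto
    have "m \<in> (\<lambda>h. service_cost (A - {h}) - service_cost A) ` R"
      unfolding m_def using Rne fin(2) by (intro Min_in) auto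
    then have m2: "service_cost (A - {g}) - service_cost A \<le> m" if "g \<in> R'" for g
      using cheap that R'(1) by fastforce
    have "(\<Sum>g\<in>R'. service_cost (A - {g}) - service_cost A) \<le> of_nat (card R') * m"
      by (rule sum_bounded_above) (rule m2)
    also have "\<dots> = of_nat (card R) * m" using R' R by simp
    also have "\<dots> \<le> (\<Sum>h\<in>R. service_cost (A - {h}) - service_cost A)"
      by (rule sum_bounded_below) (rule m1)
    finally show ?thesis .
  qed
  then have "Z \<le> (\<Sum>c\<in>C. if p c \<in> R then v c else d c (p c))"
    unfolding service_cost_plus[OF fin(2), symmetric] Z_def by simp
  also have "\<dots> \<le> service_cost (A - R)"
    unfolding service_cost_def
  proof (rule sum_mono)
    fix c
    have "serve A c \<le> serve (A - R) c" using A(1) RA by (intro serve_antimono) auto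
    moreover have "serve (A - {p c}) c \<le> serve (A - R) c" if "p c \<in> R"
      using A(1) RA that by (intro serve_antimono) auto
    ultimately show "(if p c \<in> R then v c else d c (p c)) \<le> serve (A - R) c"
      using s(2)[of c] p(2)[of c] by (simp add: v_def)
  qed
  finally have Z_le: "Z \<le> service_cost (A - R)" .

  have Z_eq: "Z = (\<Sum>c\<in>C. if p c \<in> R' then v c else d c (p c))"
    unfolding Z_def by (rule service_cost_plus[OF fR'])
  \<comment> \<open>The full estimate \<open>Z\<close> is needed on the right: a price counts only
    \<open>v c - d c (p c)\<close>, which may be far below \<open>v c\<close>, and
    \<open>service_cost A\<close> supplies the missing part.\<close>
  have sumW: "(\<Sum>g\<in>R'. W g) \<le> Z"
  proof -
    have "(\<Sum>g\<in>R'. W g) = (\<Sum>g\<in>R'. \<Sum>c\<in>{c \<in> {c \<in> C. p c \<in> R'}. p c = g}. v c)"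
      unfolding W_def by (intro sum.cong) (auto simp: Cl_def)
    also have "\<dots> = (\<Sum>c\<in>{c \<in> C. p c \<in> R'}. v c)"
      using fR' finite_clients by (intro sum.group) auto
    also have "\<dots> = (\<Sum>c\<in>C. if p c \<in> R' then v c else 0)"
      by (rule sum.inter_filter[OF finite_clients])
    also have "\<dots> \<le> Z" unfolding Z_eq by (intro sum_mono) (auto simp: p0)
    finally show ?thesis .
  qed

  have pt: "serve (A - R') c \<le> (if p c \<in> R' then v c else d c (p c))
      + (if p c \<in> R' \<and> s c \<in> R' then 2 * v c else 0)" if c: "c \<in> C" for c
  proof -
    consider "p c \<notin> R'" | "p c \<in> R'" "s c \<notin> R'" | "p c \<in> R'" "s c \<in> R'" by blast
    then show ?thesis
    proof cases
      case 1
      then show ?thesis using serve_le[of "A - R'" "p c" c] A(1) p(1)[of c] by simp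
    next
      case 2
      then show ?thesis using serve_le[of "A - R'" "s c" c] A(1) s(1)[of c] by (simp add: v_def)
    next
      case 3
      let ?g = "p c"
      have "(?g, n ?g) \<in> E" by (simp add: E_def)
      then have "n ?g \<notin> R'" using R'(3)[of ?g "n ?g"] 3(1) n(1)[of ?g] by force
      then have "serve (A - R') c \<le> d c (n ?g)" using A(1) n(1)[of ?g] by (intro serve_le) auto
      also have "\<dots> \<le> d c ?g + d ?g (n ?g)"
        using c cX inX p(1) n(1) by (intro dist_triangle) auto
      \<comment> \<open>\<open>s c\<close> differs from \<open>?g\<close>, so it competes for being
        the facility nearest to \<open>?g\<close>.\<close>
      also have "d ?g (n ?g) \<le> d ?g (s c)"
        unfolding n(2) using A(1) s(1) by (intro serve_le) auto
      also have "d ?g (s c) \<le> d ?g c + d c (s c)"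
        using c cX inX p(1) s(1) by (intro dist_triangle) auto
      also have "d ?g c = d c ?g" using c cX inX p(1) by (intro dist_sym) auto
      finally have "serve (A - R') c \<le> d c ?g + (d c ?g + v c)" by (simp add: v_def)
      then show ?thesis using 3 pv[of c] by simp
    qed
  qed
  have "service_cost (A - R') \<le> (\<Sum>c\<in>C. (if p c \<in> R' then v c else d c (p c))
      + (if p c \<in> R' \<and> s c \<in> R' then 2 * v c else 0))"
    unfolding service_cost_def by (intro sum_mono pt)
  also have "\<dots> = Z + (\<Sum>c\<in>{c \<in> C. p c \<in> R' \<and> s c \<in> R'}. 2 * v c)"
    unfolding sum.distrib Z_eq sum.inter_filter[OF finite_clients] ..
  also have "(\<Sum>c\<in>{c \<in> C. p c \<in> R' \<and> s c \<in> R'}. 2 * v c)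
      = 2 * (\<Sum>g\<in>R'. \<Sum>g'\<in>R'. J g g')"
  proof -
    have "(\<Sum>g\<in>R'. \<Sum>g'\<in>R'. J g g')
        = (\<Sum>g\<in>R'. \<Sum>c\<in>{c \<in> {c \<in> C. p c \<in> R' \<and> s c \<in> R'}. p c = g}. v c)"
      unfolding sumJ[OF fR'] by (intro sum.cong) (auto simp: Cl_def)
    also have "\<dots> = (\<Sum>c\<in>{c \<in> C. p c \<in> R' \<and> s c \<in> R'}. v c)"
      using fR' finite_clients by (intro sum.group) auto
    finally show ?thesis by (simp add: sum_distrib_left)
  qed
  \<comment> \<open>For fixed \<open>g\<close>, absence of conflicts bounds each of the
    \<open>k\<close> shares by \<open>\<delta> * W g\<close>; the diagonal share vanishes because
    \<open>s c\<close> is never \<open>p c\<close>.\<close>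
  also have "(\<Sum>g\<in>R'. \<Sum>g'\<in>R'. J g g') \<le> (\<Sum>g\<in>R'. of_nat (card R') * (\<delta> * W g))"
  proof (intro sum_mono sum_bounded_above)
    fix g g' assume gg: "g \<in> R'" "g' \<in> R'"
    show "J g g' \<le> \<delta> * W g"
    proof (cases "g = g'")
      case True
      then have empty: "{c \<in> Cl g. s c = g'} = {}" using s(1) by (auto simp: Cl_def)
      show ?thesis unfolding J_def empty using W0[of g] \<delta>(1) by simp
    next
      case False
      then show ?thesis using R'(3)[OF gg] by (auto simp: E_def not_less)
    qed
  qed
  also have "(\<Sum>g\<in>R'. of_nat (card R') * (\<delta> * W g)) = real k * \<delta> * (\<Sum>g\<in>R'. W g)"
    using R'(2) by (simp add: sum_distrib_left mult.assoc)
  also have "\<dots> \<le> real k * \<delta> * Z" using sumW \<delta>(1) by (intro mult_left_mono) auto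
  finally have "service_cost (A - R') \<le> (1 + 2 * real k * \<delta>) * Z" by (simp add: algebra_simps)
  also have "\<dots> \<le> (1 + 2 * real k * \<delta>) * service_cost (A - R)"
    using Z_le \<delta>(1) by (intro mult_left_mono) auto
  finally show ?thesis using R' by blast
qed

end

subsection \<open>Symbolic execution\<close>

text \<open>A weakest precondition for total correctness whose postcondition also sees the step
  count.\<close>

definition wp :: "program \<Rightarrow> val list \<Rightarrow> expr \<Rightarrow> (val \<Rightarrow> nat \<Rightarrow> bool) \<Rightarrow> bool" where
  "wp P env e Q \<longleftrightarrow> (\<exists>v t. eval P env e v t \<and> Q v t)"

definition wps :: "program \<Rightarrow> val list \<Rightarrow> expr list \<Rightarrow> (val list \<Rightarrow> nat \<Rightarrow> bool) \<Rightarrow> bool" where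
  "wps P env es Q \<longleftrightarrow> (\<exists>vs t. evals P env es vs t \<and> Q vs t)"

definition fn :: "program \<Rightarrow> nat \<Rightarrow> val list \<Rightarrow> val \<Rightarrow> nat \<Rightarrow> bool" where
  "fn P f vs v t \<longleftrightarrow> f < length P \<and> eval P vs (P ! f) v t"

definition call :: "program \<Rightarrow> nat \<Rightarrow> val list \<Rightarrow> (val \<Rightarrow> nat \<Rightarrow> bool) \<Rightarrow> bool" where
  "call P f vs Q \<longleftrightarrow> (\<exists>v t. fn P f vs v t \<and> Q v t)"

lemmas eval_intros = eval_evals.intros[unfolded One_nat_def plus_1_eq_Suc add_Suc add_0]

lemma wp_Var: "wp P env (Var i) Q \<longleftrightarrow> i < length env \<and> Q (env ! i) (Suc 0)"
  unfolding wp_def by (rule iffI, (elim exE conjE eval_VarE, hypsubst?, intro exI conjI, (assumption | rule refl)+),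
      elim exE conjE, hypsubst?, intro exI conjI, rule eval_intros(1), assumption+)

lemma wp_Const: "wp P env (Const q) Q \<longleftrightarrow> Q (Leaf q) (Suc 0)"
  unfolding wp_def by (rule iffI, (elim exE conjE eval_ConstE, hypsubst, assumption),
      intro exI conjI, rule eval_intros(2), assumption)

lemma wp_Add: "wp P env (Add e1 e2) Q \<longleftrightarrow>
    wp P env e1 (\<lambda>v1 t1. \<exists>p. v1 = Leaf p \<and>
      wp P env e2 (\<lambda>v2 t2. \<exists>q. v2 = Leaf q \<and> Q (Leaf (p + q)) (Suc (t1 + t2))))"
  unfolding wp_def by (rule iffI, (elim exE conjE eval_AddE, hypsubst?, intro exI conjI, (assumption | rule refl)+),
      elim exE conjE, hypsubst?, intro exI conjI, rule eval_intros(3), assumption+)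

lemma wp_Sub: "wp P env (Sub e1 e2) Q \<longleftrightarrow>
    wp P env e1 (\<lambda>v1 t1. \<exists>p. v1 = Leaf p \<and>
      wp P env e2 (\<lambda>v2 t2. \<exists>q. v2 = Leaf q \<and> Q (Leaf (p - q)) (Suc (t1 + t2))))"
  unfolding wp_def by (rule iffI, (elim exE conjE eval_SubE, hypsubst?, intro exI conjI, (assumption | rule refl)+),
      elim exE conjE, hypsubst?, intro exI conjI, rule eval_intros(4), assumption+)

lemma wp_MkNode: "wp P env (MkNode e1 e2) Q \<longleftrightarrow>
    wp P env e1 (\<lambda>v1 t1. wp P env e2 (\<lambda>v2 t2. Q (Node v1 v2) (Suc (t1 + t2))))"
  unfolding wp_def by (rule iffI, (elim exE conjE eval_MkNodeE, hypsubst?, intro exI conjI, (assumption | rule refl)+),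
      elim exE conjE, hypsubst?, intro exI conjI, rule eval_intros(5), assumption+)

lemma wp_Left: "wp P env (Left e) Q \<longleftrightarrow> wp P env e (\<lambda>v t. \<exists>a b. v = Node a b \<and> Q a (Suc t))"
  unfolding wp_def by (rule iffI, (elim exE conjE eval_LeftE, hypsubst?, intro exI conjI, (assumption | rule refl)+),
      elim exE conjE, hypsubst?, intro exI conjI, rule eval_intros(6), assumption+)

lemma wp_Right: "wp P env (Right e) Q \<longleftrightarrow> wp P env e (\<lambda>v t. \<exists>a b. v = Node a b \<and> Q b (Suc t))"
  unfolding wp_def by (rule iffI, (elim exE conjE eval_RightE, hypsubst?, intro exI conjI, (assumption | rule refl)+),
      elim exE conjE, hypsubst?, intro exI conjI, rule eval_intros(7), assumption+)

lemma wp_IfLess: "wp P env (IfLess e1 e2 e3 e4) Q \<longleftrightarrow>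
    wp P env e1 (\<lambda>v1 t1. \<exists>p. v1 = Leaf p \<and> wp P env e2 (\<lambda>v2 t2. \<exists>q. v2 = Leaf q \<and>
      (if p < q then wp P env e3 (\<lambda>v t. Q v (Suc (t1 + t2 + t)))
       else wp P env e4 (\<lambda>v t. Q v (Suc (t1 + t2 + t))))))"
proof -
  have eq: "(if b then wp P env e3 R else wp P env e4 R) = wp P env (if b then e3 else e4) R" for b R
    by simp
  show ?thesis unfolding eq
    unfolding wp_def by (rule iffI, (elim exE conjE eval_IfLessE, hypsubst?, intro exI conjI, (assumption | rule refl)+),
      elim exE conjE, hypsubst?, intro exI conjI, rule eval_intros(8), assumption+)
qed

lemma wp_IfNode: "wp P env (IfNode e1 e2 e3) Q \<longleftrightarrow>
    wp P env e1 (\<lambda>u t1. case u of Node _ _ \<Rightarrow> wp P env e2 (\<lambda>v t. Q v (Suc (t1 + t)))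
      | Leaf _ \<Rightarrow> wp P env e3 (\<lambda>v t. Q v (Suc (t1 + t))))"
proof -
  have eq: "(case u of Node _ _ \<Rightarrow> wp P env e2 R | Leaf _ \<Rightarrow> wp P env e3 R)
      = wp P env (case u of Node _ _ \<Rightarrow> e2 | Leaf _ \<Rightarrow> e3) R" for u R
    by (simp split: val.split)
  show ?thesis unfolding eq
    unfolding wp_def by (rule iffI, (elim exE conjE eval_IfNodeE, hypsubst?, intro exI conjI, (assumption | rule refl)+),
      elim exE conjE, hypsubst?, intro exI conjI, rule eval_intros(9), assumption+)
qed

lemma wp_LetIn: "wp P env (LetIn e1 e2) Q \<longleftrightarrow>
    wp P env e1 (\<lambda>u t1. wp P (u # env) e2 (\<lambda>v t2. Q v (Suc (t1 + t2))))"
  unfolding wp_def by (rule iffI, (elim exE conjE eval_LetInE, hypsubst?, intro exI conjI, (assumption | rule refl)+),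
      elim exE conjE, hypsubst?, intro exI conjI, rule eval_intros(10), assumption+)

lemma wp_Call: "wp P env (Call f es) Q \<longleftrightarrow>
    wps P env es (\<lambda>vs t1. call P f vs (\<lambda>v t2. Q v (Suc (t1 + t2))))"
  unfolding wp_def wps_def call_def fn_def by (rule iffI, (elim exE conjE eval_CallE, hypsubst?, intro exI conjI, (assumption | rule refl)+),
      elim exE conjE, hypsubst?, intro exI conjI, rule eval_intros(11), assumption+)

lemma wps_Nil: "wps P env [] Q \<longleftrightarrow> Q [] 0"
  unfolding wps_def by (rule iffI, (elim exE conjE evals_NilE, hypsubst, assumption),
      intro exI conjI, rule eval_intros(12), assumption)

lemma wps_Cons: "wps P env (e # es) Q \<longleftrightarrow>
    wp P env e (\<lambda>v t1. wps P env es (\<lambda>vs t2. Q (v # vs) (t1 + t2)))"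
  unfolding wp_def wps_def by (rule iffI, (elim exE conjE evals_ConsE, hypsubst?, intro exI conjI, (assumption | rule refl)+),
      elim exE conjE, hypsubst?, intro exI conjI, rule eval_intros(13), assumption+)

lemmas wp_simps = wp_Var wp_Const wp_Add wp_Sub wp_MkNode wp_Left wp_Right wp_IfLess wp_IfNode
  wp_LetIn wp_Call wps_Nil wps_Cons

lemma call_unfold: "call P f vs Q \<longleftrightarrow> f < length P \<and> wp P vs (P ! f) Q"
  unfolding call_def fn_def wp_def by blast

text \<open>Because evaluation is deterministic, the wp rules are equations, so the simplifier executes
  function bodies symbolically and consumes known runs of subroutines through this one.\<close>

lemma call_eq: "fn P f vs v t \<Longrightarrow> call P f vs Q \<longleftrightarrow> Q v t"
  unfolding call_def fn_def by (blast dest: eval_deterministic(1))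

text \<open>Exact step counts depend on the data, so facts about functions keep only an upper bound;
  \<open>runs_withinE\<close> recovers an exact run in the form that \<open>call_eq\<close>
  consumes.\<close>

definition runs_within :: "program \<Rightarrow> nat \<Rightarrow> val list \<Rightarrow> val \<Rightarrow> nat \<Rightarrow> bool" where
  "runs_within P f vs v T \<longleftrightarrow> (\<exists>t\<le>T. fn P f vs v t)"

lemma runs_withinI: "call P f vs (\<lambda>v' t. v' = v \<and> t \<le> T) \<Longrightarrow> runs_within P f vs v T"
  unfolding runs_within_def call_def by blast

lemma runs_withinE:
  assumes "runs_within P f vs v T"
  obtains t where "t \<le> T" "fn P f vs v t"
  using assms unfolding runs_within_def by blast

subsection \<open>The program\<close>

text \<open>The language compares only by \<open><\<close>; equality is the failure of both strict
  comparisons.\<close>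

definition if_eq :: "expr \<Rightarrow> expr \<Rightarrow> expr \<Rightarrow> expr \<Rightarrow> expr" where
  "if_eq e1 e2 e3 e4 = IfLess e1 e2 e4 (IfLess e2 e1 e4 e3)"

text \<open>Function 1. Arguments: point, point, distance table. In all function bodies the arguments
  are Var 0, Var 1, ..., shifted by one under each let.\<close>

definition lookup_body :: expr where
  "lookup_body =
     IfNode (Var 2)
       (LetIn (Left (Var 2))
         (if_eq (Left (Var 0)) (Var 1)
           (if_eq (Left (Right (Var 0))) (Var 2) (Right (Right (Var 0)))
             (Call 1 [Var 1, Var 2, Right (Var 3)]))
           (Call 1 [Var 1, Var 2, Right (Var 3)])))
       (Const 0)"

text \<open>Function 2: distance to a nearest facility, and that facility.
  Arguments: client, open facilities, table.\<close>

definition nearest_body :: expr where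
  "nearest_body =
     IfNode (Var 1)
       (LetIn (Call 1 [Var 0, Left (Var 1), Var 2])
         (IfNode (Right (Var 2))
           (LetIn (Call 2 [Var 1, Right (Var 2), Var 3])
             (IfLess (Left (Var 0)) (Var 1) (Var 0) (MkNode (Var 1) (Left (Var 3)))))
           (MkNode (Var 0) (Left (Var 2)))))
       (MkNode (Const 0) (Const 0))"

text \<open>Function 3. Arguments: clients, open facilities, table.\<close>

definition cost_body :: expr where
  "cost_body =
     IfNode (Var 0)
       (Add (Left (Call 2 [Left (Var 0), Var 1, Var 2])) (Call 3 [Right (Var 0), Var 1, Var 2]))
       (Const 0)"

text \<open>Function 4. Arguments: facility, list.\<close>

definition remove_body :: expr where
  "remove_body =
     IfNode (Var 1)
       (if_eq (Left (Var 1)) (Var 0) (Right (Var 1))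
         (MkNode (Left (Var 1)) (Call 4 [Var 0, Right (Var 1)])))
       (Const 0)"

text \<open>Function 5: insertion into a list of pairs sorted by first component. Arguments: pair, list.\<close>

definition insert_body :: expr where
  "insert_body =
     IfNode (Var 1)
       (IfLess (Left (Left (Var 1))) (Left (Var 0))
         (MkNode (Left (Var 1)) (Call 5 [Var 0, Right (Var 1)]))
         (MkNode (Var 0) (Var 1)))
       (MkNode (Var 0) (Const 0))"

text \<open>Function 6: the sorted list of the pairs (cost of A - g, A - g) for g in B.
  Arguments: B, A, clients, table.\<close>

definition children_body :: expr where
  "children_body =
     IfNode (Var 0)
       (LetIn (Call 4 [Left (Var 0), Var 1])
         (Call 5 [MkNode (Call 3 [Var 3, Var 0, Var 4]) (Var 0),
                  Call 6 [Right (Var 1), Var 2, Var 3, Var 4]]))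
       (Const 0)"

text \<open>Function 7: the cheapest solution below the first n entries of L, with k closures still to
  be made; a leaf if there is none. Arguments: n, L, k, branching width, clients, table.\<close>

definition branch_body :: expr where
  "branch_body =
     IfNode (Var 1)
       (IfLess (Var 0) (Const 1) (Const 0)
         (LetIn (Call 8 [Var 2, Right (Left (Var 1)), Var 3, Var 4, Var 5])
           (LetIn (Call 7 [Sub (Var 1) (Const 1), Right (Var 2), Var 3, Var 4, Var 5, Var 6])
             (IfNode (Var 0)
               (IfLess (Left (Var 0)) (Left (Var 1)) (Var 0) (Var 1))
               (Var 1)))))
       (Const 0)"

text \<open>Function 8: a cheap way to close k of the facilities A.
  Arguments: k, A, branching width, clients, table.\<close>

definition solve_body :: expr where
  "solve_body =
     IfLess (Var 0) (Const 1)
       (MkNode (Call 3 [Var 3, Var 1, Var 4]) (Var 1))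
       (Call 7 [Var 2, Call 6 [Var 1, Var 1, Var 3, Var 4], Sub (Var 0) (Const 1),
                Var 2, Var 3, Var 4])"

text \<open>Function 9: repeated addition, linear in the first factor. That factor is always the
  parameter of the instance, which feasibility bounds by the number of facilities.\<close>

definition mult_body :: expr where
  "mult_body =
     IfLess (Var 0) (Const 1) (Const 0) (Add (Var 1) (Call 9 [Sub (Var 0) (Const 1), Var 1]))"

text \<open>Function 10: the graph of the assignment. Arguments: clients, open facilities, table.\<close>

definition assign_body :: expr where
  "assign_body =
     IfNode (Var 0)
       (MkNode (MkNode (Left (Var 0)) (Right (Call 2 [Left (Var 0), Var 1, Var 2])))
               (Call 10 [Right (Var 0), Var 1, Var 2]))
       (Const 0)"

text \<open>The first binding is the branching width l^3 * \<open>b\<close>. Precomputing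
  \<open>b\<close> outside the program avoids any division at run time.\<close>

definition main_body :: "nat \<Rightarrow> expr" where
  "main_body b =
     LetIn (Call 9 [Left (Var 0), Call 9 [Left (Var 0), Call 9 [Left (Var 0), Const (of_nat b)]]])
       (LetIn (Call 8 [Left (Var 1), Left (Right (Var 1)), Var 0, Left (Right (Right (Var 1))),
                       Right (Right (Right (Var 1)))])
         (MkNode (Right (Var 0))
           (Call 10 [Left (Right (Right (Var 2))), Right (Var 0), Right (Right (Right (Var 2)))])))"

definition prog :: "nat \<Rightarrow> program" where
  "prog b = [main_body b, lookup_body, nearest_body, cost_body, remove_body, insert_body,
     children_body, branch_body, solve_body, mult_body, assign_body]"

lemma length_prog: "length (prog b) = 11"
  by (simp add: prog_def)

lemma prog_nth:
  "prog b ! 0 = main_body b" "prog b ! 1 = lookup_body" "prog b ! Suc 0 = lookup_body"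
  "prog b ! 2 = nearest_body" "prog b ! 3 = cost_body" "prog b ! 4 = remove_body"
  "prog b ! 5 = insert_body" "prog b ! 6 = children_body" "prog b ! 7 = branch_body"
  "prog b ! 8 = solve_body" "prog b ! 9 = mult_body" "prog b ! 10 = assign_body"
  by (simp_all add: prog_def)

lemmas exec_simps = wp_simps length_prog prog_nth if_eq_def

section \<open>Encodings, and results and step bounds of the single functions\<close>

definition nats :: "nat list \<Rightarrow> val" where
  "nats xs = list_val (map nat_val xs)"

lemma nats_simps [simp]: "nats [] = Leaf 0" "nats (x # xs) = Node (Leaf (of_nat x)) (nats xs)"
  by (simp_all add: nats_def nat_val_def)

text \<open>\<open>dist_val\<close> with the list of pairs left free, which permits induction along
  the table.\<close>

definition table :: "(nat \<Rightarrow> nat \<Rightarrow> rat) \<Rightarrow> (nat \<times> nat) list \<Rightarrow> val" where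
  "table d ps = list_val (map (\<lambda>(x, y). Node (nat_val x) (Node (nat_val y) (Leaf (d x y)))) ps)"

lemma table_simps [simp]: "table d [] = Leaf 0"
  "table d (p # ps) = Node (Node (Leaf (of_nat (fst p)))
     (Node (Leaf (of_nat (snd p))) (Leaf (d (fst p) (snd p))))) (table d ps)"
  by (simp_all add: table_def nat_val_def split: prod.split)

text \<open>A linear scan. The numerical constants in this and the later step bounds are generous
  round figures.\<close>

lemma lookup_runs:
  "(x, y) \<in> set ps \<Longrightarrow>
   runs_within (prog b) 1 [nat_val x, nat_val y, table d ps] (Leaf (d x y)) (40 * length ps)"
proof (induction ps)
  case (Cons p ps)
  show ?case
  proof (cases "p = (x, y)")
    case True
    then show ?thesis
      by (intro runs_withinI) (simp add: call_unfold exec_simps lookup_body_def nat_val_def)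
  next
    case False
    then obtain t where t: "t \<le> 40 * length ps"
      "fn (prog b) 1 [nat_val x, nat_val y, table d ps] (Leaf (d x y)) t"
      using Cons by (auto elim!: runs_withinE)
    show ?thesis using False t(1) t(2)[unfolded nat_val_def] 
      apply (intro runs_withinI) 
      apply (subst call_unfold)
      apply (auto simp add: exec_simps lookup_body_def nat_val_def call_eq prod_eq_iff)
      done
  qed
qed simp

text \<open>Follows \<open>nearest_body\<close>. The singleton is a separate base case because there
  is no infinite distance to start from. The pair for the empty list is a mere default: while there
  are clients, the algorithm keeps a facility open.\<close>

fun nearest :: "(nat \<Rightarrow> nat \<Rightarrow> rat) \<Rightarrow> nat \<Rightarrow> nat list \<Rightarrow> rat \<times> nat" where
  "nearest d c [] = (0, 0)"
| "nearest d c [a] = (d c a, a)"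
| "nearest d c (a # a' # A) =
     (let r = nearest d c (a' # A) in if fst r < d c a then r else (d c a, a))"

lemma nearest_correct:
  "A \<noteq> [] \<Longrightarrow> snd (nearest d c A) \<in> set A \<and> d c (snd (nearest d c A)) = fst (nearest d c A) \<and>
    fst (nearest d c A) = Min (d c ` set A)"
proof (induction d c A rule: nearest.induct)
  case (3 d c a a' A)
  define r where "r = nearest d c (a' # A)"
  have r: "snd r \<in> set (a' # A)" "d c (snd r) = fst r" "fst r = Min (d c ` set (a' # A))"
    using 3 by (auto simp: r_def)
  have eq: "nearest d c (a # a' # A) = (if fst r < d c a then r else (d c a, a))"
    by (simp add: r_def Let_def)
  have "Min (d c ` set (a # a' # A)) = min (d c a) (fst r)"
    unfolding r(3) by simp
  with r(1,2) show ?case unfolding eq by (simp add: min_def)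
qed auto

definition list_cost :: "(nat \<Rightarrow> nat \<Rightarrow> rat) \<Rightarrow> nat list \<Rightarrow> nat list \<Rightarrow> rat" where
  "list_cost d cs A = (\<Sum>c\<leftarrow>cs. fst (nearest d c A))"

lemma nearest_runs:
  "set A \<subseteq> {a. (c, a) \<in> set ps} \<Longrightarrow>
   runs_within (prog b) 2 [nat_val c, nats A, table d ps]
     (Node (Leaf (fst (nearest d c A))) (nat_val (snd (nearest d c A))))
     ((40 * length ps + 40) * length A + 10)"
proof (induction d c A rule: nearest.induct)
  case (1 d c)
  show ?case
    by (intro runs_withinI) (simp add: call_unfold exec_simps nearest_body_def nat_val_def)
next
  case (2 d c a)
  then obtain t where t: "t \<le> 40 * length ps"
    "fn (prog b) 1 [nat_val c, nat_val a, table d ps] (Leaf (d c a)) t"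
    using lookup_runs[of c a ps b d] by (auto elim!: runs_withinE)
  show ?case using t(1) t(2)[unfolded nat_val_def]
    by (intro runs_withinI, subst call_unfold)
      (simp add: exec_simps nearest_body_def nat_val_def call_eq)
next
  case (3 d c a a' A)
  then obtain t where t: "t \<le> 40 * length ps"
    "fn (prog b) 1 [nat_val c, nat_val a, table d ps] (Leaf (d c a)) t"
    using lookup_runs[of c a ps b d] by (auto elim!: runs_withinE)
  from 3 obtain t' where t': "t' \<le> (40 * length ps + 40) * length (a' # A) + 10"
    "fn (prog b) 2 [nat_val c, nats (a' # A), table d ps]
     (Node (Leaf (fst (nearest d c (a' # A)))) (nat_val (snd (nearest d c (a' # A))))) t'"
    by (auto elim!: runs_withinE)
  show ?case using t(1) t'(1) t(2)[unfolded nat_val_def] t'(2)[unfolded nat_val_def nats_simps]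
    by (intro runs_withinI, subst call_unfold)
      (simp add: exec_simps nearest_body_def nat_val_def call_eq Let_def algebra_simps)
qed

lemma list_cost_runs:
  "set cs \<times> set A \<subseteq> set ps \<Longrightarrow>
   runs_within (prog b) 3 [nats cs, nats A, table d ps] (Leaf (list_cost d cs A))
     (((40 * length ps + 40) * length A + 30) * length cs + 10)"
proof (induction cs)
  case Nil
  show ?case
    by (intro runs_withinI) (simp add: call_unfold exec_simps cost_body_def list_cost_def)
next
  case (Cons c cs)
  from Cons.prems have "set A \<subseteq> {a. (c, a) \<in> set ps}" by auto
  then obtain t where t: "t \<le> (40 * length ps + 40) * length A + 10"
    "fn (prog b) 2 [nat_val c, nats A, table d ps]
      (Node (Leaf (fst (nearest d c A))) (nat_val (snd (nearest d c A)))) t"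
    using nearest_runs by (metis runs_withinE)
  from Cons obtain t' where t': "t' \<le> ((40 * length ps + 40) * length A + 30) * length cs + 10"
    "fn (prog b) 3 [nats cs, nats A, table d ps] (Leaf (list_cost d cs A)) t'"
    by (auto elim!: runs_withinE)
  show ?case using t(1) t'(1) t(2)[unfolded nat_val_def] t'(2)
    by (intro runs_withinI, subst call_unfold)
      (simp add: exec_simps cost_body_def nat_val_def call_eq list_cost_def algebra_simps)
qed

lemma remove_runs:
  "runs_within (prog b) 4 [nat_val g, nats A] (nats (remove1 g A)) (30 * length A + 10)"
proof (induction A)
  case Nil
  show ?case
    by (intro runs_withinI) (simp add: call_unfold exec_simps remove_body_def)
next
  case (Cons a A)
  then obtain t where t: "t \<le> 30 * length A + 10"
    "fn (prog b) 4 [nat_val g, nats A] (nats (remove1 g A)) t"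
    by (auto elim!: runs_withinE)
  show ?case using t(1) t(2)[unfolded nat_val_def]
    by (intro runs_withinI, subst call_unfold)
      (auto simp: exec_simps remove_body_def nat_val_def call_eq)
qed

definition item :: "rat \<times> nat list \<Rightarrow> val" where
  "item x = Node (Leaf (fst x)) (nats (snd x))"

definition items :: "(rat \<times> nat list) list \<Rightarrow> val" where
  "items xs = list_val (map item xs)"

lemma items_simps [simp]: "items [] = Leaf 0"
  "items (x # xs) = Node (Node (Leaf (fst x)) (nats (snd x))) (items xs)"
  by (simp_all add: items_def item_def)

lemma insert_runs:
  "runs_within (prog b) 5 [item x, items L] (items (insort_key fst x L)) (30 * length L + 10)"
proof (induction L)
  case Nil
  show ?case
    by (intro runs_withinI) (simp add: call_unfold exec_simps insert_body_def item_def)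
next
  case (Cons y L)
  then obtain t where t: "t \<le> 30 * length L + 10"
    "fn (prog b) 5 [item x, items L] (items (insort_key fst x L)) t"
    by (auto elim!: runs_withinE)
  show ?case using t(1) t(2)[unfolded item_def]
    by (intro runs_withinI, subst call_unfold)
      (auto simp: exec_simps insert_body_def item_def call_eq)
qed

definition children :: "(nat \<Rightarrow> nat \<Rightarrow> rat) \<Rightarrow> nat list \<Rightarrow> nat list \<Rightarrow> nat list \<Rightarrow> (rat \<times> nat list) list"
  where "children d cs A B = sort_key fst (map (\<lambda>g. (list_cost d cs (remove1 g A), remove1 g A)) B)"

text \<open>\<open>sort_key\<close> is insertion sort, and this is one step of it, matching the
  recursion of \<open>children_body\<close>.\<close>

lemma children_Cons: "children d cs A (g # B) =
    insort_key fst (list_cost d cs (remove1 g A), remove1 g A) (children d cs A B)"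
  by (simp add: children_def)

lemma length_children: "length (children d cs A B) = length B"
  by (simp add: children_def)

lemma children_runs:
  assumes "set cs \<times> set A \<subseteq> set ps" and "length A \<le> m" and "length B \<le> m"
  shows "runs_within (prog b) 6 [nats B, nats A, nats cs, table d ps] (items (children d cs A B))
     ((((40 * length ps + 40) * m + 30) * length cs + 60 * m + 100) * length B + 10)"
  using assms(3)
proof (induction B)
  case Nil
  show ?case
    by (intro runs_withinI) (simp add: call_unfold exec_simps children_body_def children_def)
next
  case (Cons g B)
  let ?A = "remove1 g A"
  obtain t1 where t1: "t1 \<le> 30 * length A + 10"
    "fn (prog b) 4 [nat_val g, nats A] (nats ?A) t1"
    using remove_runs by (metis runs_withinE)
  have "set cs \<times> set ?A \<subseteq> set ps" using assms(1) set_remove1_subset[of g A] by blast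
  then obtain t2 where t2: "t2 \<le> ((40 * length ps + 40) * length ?A + 30) * length cs + 10"
    "fn (prog b) 3 [nats cs, nats ?A, table d ps] (Leaf (list_cost d cs ?A)) t2"
    using list_cost_runs by (metis runs_withinE)
  have "length ?A \<le> m" using assms(2) by (auto simp: length_remove1)
  then have "((40 * length ps + 40) * length ?A + 30) * length cs
      \<le> ((40 * length ps + 40) * m + 30) * length cs"
    by (intro mult_right_mono add_mono mult_left_mono) auto
  with t2(1) have t2': "t2 \<le> ((40 * length ps + 40) * m + 30) * length cs + 10" by linarith
  obtain t3 where t3: "t3 \<le> (((40 * length ps + 40) * m + 30) * length cs + 60 * m + 100) * length B + 10"
    "fn (prog b) 6 [nats B, nats A, nats cs, table d ps] (items (children d cs A B)) t3"
    using Cons by (auto elim!: runs_withinE)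
  obtain t4 where t4: "t4 \<le> 30 * length B + 10"
    "fn (prog b) 5 [item (list_cost d cs ?A, ?A), items (children d cs A B)]
      (items (children d cs A (g # B))) t4"
    using insert_runs[of b _ "children d cs A B"] unfolding children_Cons length_children
    by (metis runs_withinE)
  have len: "length A \<le> m" "length B \<le> m" using assms(2) Cons.prems by auto
  show ?case
    using t1(1) t2' t3(1) t4(1) t1(2)[unfolded nat_val_def] t2(2) t3(2) t4(2)[unfolded item_def] len
    by (intro runs_withinI, subst call_unfold)
      (simp add: exec_simps children_body_def call_eq algebra_simps)
qed

lemma mult_runs:
  "runs_within (prog b) 9 [nat_val m, nat_val x] (nat_val (m * x)) (20 * m + 10)"
proof (induction m)
  case 0
  show ?case
    by (intro runs_withinI) (simp add: call_unfold exec_simps mult_body_def nat_val_def)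
next
  case (Suc m)
  then obtain t where t: "t \<le> 20 * m + 10"
    "fn (prog b) 9 [nat_val m, nat_val x] (nat_val (m * x)) t"
    by (auto elim!: runs_withinE)
  show ?case using t(1) t(2)[unfolded nat_val_def]
    by (intro runs_withinI, subst call_unfold)
      (simp add: exec_simps mult_body_def nat_val_def call_eq)
qed

lemma assign_runs:
  "set cs \<times> set A \<subseteq> set ps \<Longrightarrow>
   runs_within (prog b) 10 [nats cs, nats A, table d ps]
     (list_val (map (\<lambda>c. Node (nat_val c) (nat_val (snd (nearest d c A)))) cs))
     (((40 * length ps + 40) * length A + 30) * length cs + 10)"
proof (induction cs)
  case Nil
  show ?case
    by (intro runs_withinI) (simp add: call_unfold exec_simps assign_body_def)
next
  case (Cons c cs)
  from Cons.prems have "set A \<subseteq> {a. (c, a) \<in> set ps}" by auto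
  then obtain t where t: "t \<le> (40 * length ps + 40) * length A + 10"
    "fn (prog b) 2 [nat_val c, nats A, table d ps]
      (Node (Leaf (fst (nearest d c A))) (nat_val (snd (nearest d c A)))) t"
    using nearest_runs by (metis runs_withinE)
  from Cons obtain t' where t': "t' \<le> ((40 * length ps + 40) * length A + 30) * length cs + 10"
    "fn (prog b) 10 [nats cs, nats A, table d ps]
     (list_val (map (\<lambda>c. Node (nat_val c) (nat_val (snd (nearest d c A)))) cs)) t'"
    by (auto elim!: runs_withinE)
  show ?case using t(1) t'(1) t(2)[unfolded nat_val_def] t'(2)[unfolded nat_val_def]
    by (intro runs_withinI, subst call_unfold)
      (simp add: exec_simps assign_body_def nat_val_def call_eq algebra_simps)
qed

text \<open>Functions 7 and 8 call each other. Abstracting the runs of function 8 into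
  \<open>res\<close> and \<open>\<tau>\<close> settles the loop over the children on its own; the
  induction on \<open>k\<close> in \<open>solve_runs\<close> later supplies the assumption. The leaf
  returned for an empty selection acts as an infinite cost when results are compared.\<close>

lemma branch_runs:
  assumes "\<And>x. x \<in> set L \<Longrightarrow>
    runs_within (prog b) 8 [nat_val k, nats (snd x), nat_val N, nats cs, table d ps] (item (res x)) \<tau>"
  shows "if take n L = []
    then runs_within (prog b) 7 [nat_val n, items L, nat_val k, nat_val N, nats cs, table d ps] (Leaf 0) 10
    else \<exists>x \<in> set (take n L). (\<forall>y \<in> set (take n L). fst (res x) \<le> fst (res y)) \<and>
      runs_within (prog b) 7 [nat_val n, items L, nat_val k, nat_val N, nats cs, table d ps]
        (item (res x)) ((\<tau> + 40) * n + 10)"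
  using assms
proof (induction L arbitrary: n)
  case Nil
  have "runs_within (prog b) 7 [nat_val n, items [], nat_val k, nat_val N, nats cs, table d ps] (Leaf 0) 10"
    by (intro runs_withinI) (simp add: call_unfold exec_simps branch_body_def)
  then show ?case by simp
next
  case (Cons x L)
  show ?case
  proof (cases n)
    case 0
    have "runs_within (prog b) 7 [nat_val 0, items (x # L), nat_val k, nat_val N, nats cs, table d ps]
      (Leaf 0) 10"
      by (intro runs_withinI) (simp add: call_unfold exec_simps branch_body_def nat_val_def)
    then show ?thesis using 0 by simp
  next
    case (Suc n')
    obtain t where t: "t \<le> \<tau>"
      "fn (prog b) 8 [nat_val k, nats (snd x), nat_val N, nats cs, table d ps] (item (res x)) t"
      using Cons.prems[of x] by (auto elim!: runs_withinE)
    show ?thesis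
    proof (cases "take n' L = []")
      case True
      then obtain t' where t': "t' \<le> 10"
        "fn (prog b) 7 [nat_val n', items L, nat_val k, nat_val N, nats cs, table d ps] (Leaf 0) t'"
        using Cons by (metis runs_withinE list.set_intros(2))
      have "runs_within (prog b) 7 [nat_val n, items (x # L), nat_val k, nat_val N, nats cs, table d ps]
        (item (res x)) ((\<tau> + 40) * n + 10)"
        using t(1) t'(1) t(2)[unfolded item_def nat_val_def] t'(2)[unfolded nat_val_def] Suc
        by (intro runs_withinI, subst call_unfold)
          (simp add: exec_simps branch_body_def nat_val_def item_def call_eq)
      then show ?thesis using Suc True by auto
    next
      case False
      then obtain y where y: "y \<in> set (take n' L)"
        "\<And>z. z \<in> set (take n' L) \<Longrightarrow> fst (res y) \<le> fst (res z)"
        "runs_within (prog b) 7 [nat_val n', items L, nat_val k, nat_val N, nats cs, table d ps]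
          (item (res y)) ((\<tau> + 40) * n' + 10)"
        using Cons.IH[of n'] Cons.prems by auto
      then obtain t' where t': "t' \<le> (\<tau> + 40) * n' + 10"
        "fn (prog b) 7 [nat_val n', items L, nat_val k, nat_val N, nats cs, table d ps]
          (item (res y)) t'"
        by (auto elim!: runs_withinE)
      define z where "z = (if fst (res y) < fst (res x) then y else x)"
      have "runs_within (prog b) 7 [nat_val n, items (x # L), nat_val k, nat_val N, nats cs, table d ps]
        (item (res z)) ((\<tau> + 40) * n + 10)"
        using t(1) t'(1) t(2)[unfolded item_def nat_val_def] t'(2)[unfolded item_def nat_val_def] Suc
        by (intro runs_withinI, subst call_unfold)
          (auto simp: exec_simps branch_body_def nat_val_def item_def call_eq z_def)
      moreover have "z \<in> set (take n (x # L))" using y(1) Suc by (auto simp: z_def)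
      moreover have "fst (res z) \<le> fst (res w)" if "w \<in> set (take n (x # L))" for w
        using that y(2)[of w] Suc by (auto simp: z_def)
      moreover have ne: "take n (x # L) \<noteq> []" using Suc by simp
      ultimately show ?thesis unfolding if_not_P[OF ne] by blast
    qed
  qed
qed

subsection \<open>Approximation guarantee\<close>

text \<open>The embedding of the rationals into the reals is monotone and therefore commutes with
  finite minima.\<close>

lemma service_cost_list_cost:
  fixes d :: "nat \<Rightarrow> nat \<Rightarrow> rat"
  assumes metric: "finite_metric X (set cs) (\<lambda>x y. of_rat (d x y))" and "distinct cs"
    and "A \<noteq> [] \<or> cs = []"
  shows "finite_metric.service_cost (set cs) (\<lambda>x y. of_rat (d x y)) (set A) = of_rat (list_cost d cs A)"
proof (cases "cs = []")
  case True
  interpret finite_metric X "set cs" "\<lambda>x y. of_rat (d x y)" by (rule metric)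
  show ?thesis unfolding service_cost_def using True by (simp add: list_cost_def)
next
  case False
  interpret finite_metric X "set cs" "\<lambda>x y. of_rat (d x y)" by (rule metric)
  have A: "A \<noteq> []" using assms(3) False by simp
  have "serve (set A) c = of_rat (fst (nearest d c A))" for c
  proof -
    have "mono (of_rat :: rat \<Rightarrow> real)" by (simp add: mono_def of_rat_less_eq)
    then have "of_rat (Min (d c ` set A)) = Min (of_rat ` (d c ` set A) :: real set)"
      using A by (intro mono_Min_commute) auto
    then show ?thesis using nearest_correct[OF A, of d c]
      by (simp add: serve_def image_image)
  qed
  then show ?thesis using assms(2)
    by (simp add: service_cost_def list_cost_def of_rat_sum sum_list_distinct_conv_sum_set)
qed

text \<open>\<open>\<alpha>\<close> pays for one node of the search tree without its subtrees, and
  40 is the overhead of function 7 per child.\<close>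

fun solve_time :: "nat \<Rightarrow> nat \<Rightarrow> nat \<Rightarrow> nat" where
  "solve_time \<alpha> N 0 = \<alpha>"
| "solve_time \<alpha> N (Suc k) = \<alpha> + N * (solve_time \<alpha> N k + 40)"

text \<open>Shifted by 40, the recurrence reads x' = (\<open>\<alpha>\<close> + 40) +
  \<open>N\<close> * x; enlarging the base to \<open>N + 1\<close> absorbs the additive
  term.\<close>

lemma solve_time_le: "solve_time \<alpha> N k + 40 \<le> (\<alpha> + 40) * (N + 1) ^ k"
proof (induction k)
  case (Suc k)
  let ?x = "(\<alpha> + 40) * (N + 1) ^ k"
  have "N * (solve_time \<alpha> N k + 40) \<le> N * ?x" by (rule mult_left_mono[OF Suc]) simp
  moreover have "\<alpha> + 40 \<le> ?x" by simp
  moreover have "?x + N * ?x = (\<alpha> + 40) * (N + 1) ^ Suc k" by (simp add: algebra_simps)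
  ultimately show ?case unfolding solve_time.simps by linarith
qed simp

text \<open>The bound is stated against every \<open>R\<close> of size \<open>k\<close>, not against
  an optimum, because an exchange replaces the comparison set before the induction hypothesis is
  applied to a subproblem. Width and loss factor use the total \<open>l\<close> rather than the
  remaining \<open>k\<close>, so they are the same at all levels. Sortedness is carried along to
  make the output the canonical encoding of a set.\<close>

lemma solve_runs:
  fixes d :: "nat \<Rightarrow> nat \<Rightarrow> rat" and X :: "nat set"
  assumes metric: "finite_metric X (set cs) (\<lambda>x y. of_rat (d x y))" and cs: "distinct cs"
    and ps: "set cs \<times> X \<subseteq> set ps"
    and \<delta>: "0 < \<delta>" "1 \<le> \<delta> * real D" and N: "l * (2 * D + 3) \<le> N"
    and S: "S = ((40 * length ps + 40) * m + 30) * length cs"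
    and \<alpha>: "\<alpha> = (S + 60 * m + 100) * m + S + 60"
  shows "distinct A \<Longrightarrow> sorted A \<Longrightarrow> set A \<subseteq> X \<Longrightarrow> k \<le> l \<Longrightarrow> length A \<le> m \<Longrightarrow>
    k < length A \<or> cs = [] \<and> k \<le> length A \<Longrightarrow>
    \<exists>B. set B \<subseteq> set A \<and> distinct B \<and> sorted B \<and> length B + k = length A \<and>
      (\<forall>R \<subseteq> set A. card R = k \<longrightarrow> of_rat (list_cost d cs B) \<le>
        (1 + 2 * real l * \<delta>) ^ k * finite_metric.service_cost (set cs) (\<lambda>x y. of_rat (d x y)) (set A - R)) \<and>
      runs_within (prog b) 8 [nat_val k, nats A, nat_val N, nats cs, table d ps]
        (item (list_cost d cs B, B)) (solve_time \<alpha> N k)"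
proof (induction k arbitrary: A)
  case 0
  interpret finite_metric X "set cs" "\<lambda>x y. of_rat (d x y)" by (rule metric)
  have "set cs \<times> set A \<subseteq> set ps" using 0 ps by blast
  then obtain t where t: "t \<le> ((40 * length ps + 40) * length A + 30) * length cs + 10"
    "fn (prog b) 3 [nats cs, nats A, table d ps] (Leaf (list_cost d cs A)) t"
    using list_cost_runs by (metis runs_withinE)
  have "((40 * length ps + 40) * length A + 30) * length cs \<le> S"
    unfolding S using 0 by (intro mult_right_mono add_mono mult_left_mono) auto
  then have "t \<le> S + 10" using t(1) by simp
  then have "runs_within (prog b) 8 [nat_val 0, nats A, nat_val N, nats cs, table d ps]
        (item (list_cost d cs A, A)) (solve_time \<alpha> N 0)"
    using t(2) by (intro runs_withinI, subst call_unfold)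
      (simp add: exec_simps solve_body_def nat_val_def item_def call_eq \<alpha>)
  moreover have "of_rat (list_cost d cs A) = service_cost (set A)"
    by (rule service_cost_list_cost[symmetric, OF metric cs]) (use 0 in auto)
  moreover have "of_rat (list_cost d cs A) \<le> (1 + 2 * real l * \<delta>) ^ 0 * service_cost (set A - R)"
    if "R \<subseteq> set A" "card R = 0" for R
  proof -
    have "R = {}" using that finite_subset by fastforce
    then show ?thesis using \<open>of_rat (list_cost d cs A) = service_cost (set A)\<close> by simp
  qed
  ultimately show ?case using 0(1,2) by (intro exI[of _ A]) auto
next
  case (Suc k)
  interpret finite_metric X "set cs" "\<lambda>x y. of_rat (d x y)" by (rule metric)
  define \<eta> where "\<eta> = 2 * real l * \<delta>"
  have \<eta>0: "0 \<le> \<eta>" using \<delta>(1) by (simp add: \<eta>_def)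
  define f where "f g = (list_cost d cs (remove1 g A), remove1 g A)" for g
  define L where "L = children d cs A A"
  have set_rm: "set (remove1 g A) = set A - {g}" for g using Suc.prems(1) by simp
  have len_rm: "length (remove1 g A) = length A - 1" if "g \<in> set A" for g
    using that by (simp add: length_remove1)
  \<comment> \<open>Thus the first \<open>N\<close> entries of \<open>L\<close> stem from distinct
    facilities, whatever ties occur among the costs.\<close>
  have inj: "inj_on f (set A)"
  proof (rule inj_onI)
    fix g h assume "g \<in> set A" "h \<in> set A" "f g = f h"
    then have "set A - {g} = set A - {h}" using set_rm by (metis f_def snd_conv)
    then show "g = h" using \<open>g \<in> set A\<close> \<open>h \<in> set A\<close> by blast
  qed
  have setL: "set L = f ` set A" by (simp add: L_def children_def f_def)
  have distL: "distinct L"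
    using Suc.prems(1) inj by (simp add: L_def children_def distinct_map f_def[abs_def])
  have lenL: "length L = length A" by (simp add: L_def length_children)
  have sortL: "sorted (map fst L)" by (simp add: L_def children_def)
  have service_cost_f: "service_cost (set A - {g}) = of_rat (fst (f g))" if "g \<in> set A" for g
  proof -
    have "remove1 g A \<noteq> [] \<or> cs = []" using Suc.prems(6) len_rm[OF that] by (auto simp flip: length_0_conv)
    then show ?thesis using service_cost_list_cost[OF metric cs, of "remove1 g A"] set_rm by (simp add: f_def)
  qed
  have "\<exists>B. set B \<subseteq> set A - {g} \<and> distinct B \<and> sorted B \<and> length B + Suc k = length A \<and>
      (\<forall>R \<subseteq> set A - {g}. card R = k \<longrightarrow> of_rat (list_cost d cs B) \<le>
        (1 + \<eta>) ^ k * service_cost (set A - {g} - R)) \<and>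
      runs_within (prog b) 8 [nat_val k, nats (remove1 g A), nat_val N, nats cs, table d ps]
        (item (list_cost d cs B, B)) (solve_time \<alpha> N k)" if "g \<in> set A" for g
  proof -
    have len: "length (remove1 g A) = length A - 1" "0 < length A"
      using len_rm[OF that] that by (auto simp: length_pos_if_in_set)
    have "k < length (remove1 g A) \<or> cs = [] \<and> k \<le> length (remove1 g A)"
      "k \<le> l" "length (remove1 g A) \<le> m" "set (remove1 g A) \<subseteq> X"
      using Suc.prems(3-6) len set_rm by auto
    from Suc.IH[OF _ _ this(4,2,3,1)] Suc.prems(1,2) obtain B where
      B: "set B \<subseteq> set A - {g}" "distinct B" "sorted B" "length B + k = length A - 1"
      "\<forall>R \<subseteq> set A - {g}. card R = k \<longrightarrow> of_rat (list_cost d cs B) \<le>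
        (1 + \<eta>) ^ k * service_cost (set A - {g} - R)"
      "runs_within (prog b) 8 [nat_val k, nats (remove1 g A), nat_val N, nats cs, table d ps]
        (item (list_cost d cs B, B)) (solve_time \<alpha> N k)"
      unfolding set_rm len(1) \<eta>_def[symmetric] by (auto simp: sorted_remove1)
    have "length B + Suc k = length A" using B(4) len(2) by linarith
    with B show ?thesis by (intro exI[of _ B] conjI)
  qed
  then obtain sol where sol: "\<And>g. g \<in> set A \<Longrightarrow> set (sol g) \<subseteq> set A - {g} \<and> distinct (sol g) \<and>
      sorted (sol g) \<and> length (sol g) + Suc k = length A \<and>
      (\<forall>R \<subseteq> set A - {g}. card R = k \<longrightarrow> of_rat (list_cost d cs (sol g)) \<le>
        (1 + \<eta>) ^ k * service_cost (set A - {g} - R)) \<and>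
      runs_within (prog b) 8 [nat_val k, nats (remove1 g A), nat_val N, nats cs, table d ps]
        (item (list_cost d cs (sol g), sol g)) (solve_time \<alpha> N k)"
    by metis
  \<comment> \<open>\<open>branch_runs\<close> wants results indexed by list entries, while
    \<open>sol\<close> is indexed by facilities; \<open>inj\<close> justifies the
    translation.\<close>
  define res where "res x = (let B = sol (inv_into (set A) f x) in (list_cost d cs B, B))" for x
  have res_f: "res (f g) = (list_cost d cs (sol g), sol g)" if "g \<in> set A" for g
    using inj that by (simp add: res_def Let_def)
  have "0 < l" using Suc.prems(4) by simp
  have "0 < l * (2 * D + 3)" using \<open>0 < l\<close> by simp
  then have N0: "0 < N" using N by linarith
  have A0: "A \<noteq> []" using Suc.prems(6) by auto
  then have ne: "take N L \<noteq> []" using N0 lenL by auto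
  have "runs_within (prog b) 8 [nat_val k, nats (snd x), nat_val N, nats cs, table d ps]
      (item (res x)) (solve_time \<alpha> N k)" if "x \<in> set L" for x
  proof -
    from that obtain g where "g \<in> set A" "x = f g" using setL by auto
    then show ?thesis using sol res_f by (simp add: f_def)
  qed
  from branch_runs[OF this, of L N] ne obtain x where x: "x \<in> set (take N L)"
    "\<And>y. y \<in> set (take N L) \<Longrightarrow> fst (res x) \<le> fst (res y)"
    "runs_within (prog b) 7 [nat_val N, items L, nat_val k, nat_val N, nats cs, table d ps]
        (item (res x)) ((solve_time \<alpha> N k + 40) * N + 10)" by auto
  obtain g where g: "g \<in> set A" "x = f g" using x(1) setL by (metis imageE in_set_takeD)
  define T where "T = {h \<in> set A. f h \<in> set (take N L)}"
  have T: "T \<subseteq> set A" by (auto simp: T_def)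
  have best: "list_cost d cs (sol g) \<le> list_cost d cs (sol h)" if "h \<in> T" for h
    using x(2)[of "f h"] that g res_f by (auto simp: T_def)
  have runs: "runs_within (prog b) 8 [nat_val (Suc k), nats A, nat_val N, nats cs, table d ps]
        (item (list_cost d cs (sol g), sol g)) (solve_time \<alpha> N (Suc k))"
  proof -
    have "set cs \<times> set A \<subseteq> set ps" using Suc.prems ps by blast
    from children_runs[OF this Suc.prems(5) Suc.prems(5), of b d] obtain t where
      t: "t \<le> (S + 60 * m + 100) * length A + 10"
      "fn (prog b) 6 [nats A, nats A, nats cs, table d ps] (items L) t"
      unfolding S L_def by (auto elim!: runs_withinE)
    have "(S + 60 * m + 100) * length A \<le> (S + 60 * m + 100) * m"
      using Suc.prems(5) by (intro mult_left_mono) auto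
    with t(1) have t1: "t \<le> (S + 60 * m + 100) * m + 10" by linarith
    obtain t' where t': "t' \<le> (solve_time \<alpha> N k + 40) * N + 10"
      "fn (prog b) 7 [nat_val N, items L, nat_val k, nat_val N, nats cs, table d ps] (item (res x)) t'"
      using x(3) by (auto elim!: runs_withinE)
    show ?thesis using t1 t'(1) t(2) t'(2)[unfolded nat_val_def] res_f[OF g(1)] g(2)
      by (intro runs_withinI, subst call_unfold)
        (simp add: exec_simps solve_body_def nat_val_def call_eq \<alpha> algebra_simps)
  qed
  have "of_rat (list_cost d cs (sol g)) \<le> (1 + \<eta>) ^ Suc k * service_cost (set A - R)"
    if R: "R \<subseteq> set A" "card R = Suc k" for R
  proof -
    \<comment> \<open>A comparison set meeting \<open>T\<close> is covered by the branch on a common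
      facility \<open>h\<close> at only \<open>k\<close> factors; the remaining factor
      \<open>1 + \<eta>\<close> is free to pay for an exchange.\<close>
    have via: "of_rat (list_cost d cs (sol g)) \<le> (1 + \<eta>) ^ k * service_cost (set A - R')"
      if R': "R' \<subseteq> set A" "card R' = Suc k" "h \<in> R'" "h \<in> T" for R' h
    proof -
      have hA: "h \<in> set A" using R' by blast
      have "card (R' - {h}) = k" "R' - {h} \<subseteq> set A - {h}" using R' by auto
      moreover have "\<forall>R \<subseteq> set A - {h}. card R = k \<longrightarrow> of_rat (list_cost d cs (sol h)) \<le>
          (1 + \<eta>) ^ k * service_cost (set A - {h} - R)"
        using sol[OF hA] by (elim conjE)
      ultimately have "of_rat (list_cost d cs (sol h)) \<le>
          (1 + \<eta>) ^ k * service_cost (set A - {h} - (R' - {h}))" by blast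
      also have "set A - {h} - (R' - {h}) = set A - R'" using R' by blast
      finally have "of_rat (list_cost d cs (sol h)) \<le> (1 + \<eta>) ^ k * service_cost (set A - R')" .
      moreover have "of_rat (list_cost d cs (sol g)) \<le> (of_rat (list_cost d cs (sol h)) :: real)"
        using best[OF R'(4)] by (simp add: of_rat_less_eq)
      ultimately show ?thesis by linarith
    qed
    have RA: "R \<noteq> set A \<or> set cs = {}"
      using Suc.prems(1,6) R distinct_card[of A] by auto
    have k0: "0 \<le> service_cost (set A - R)"
      using RA R Suc.prems(3) by (intro service_cost_nonneg) auto
    have pow: "0 \<le> (1 + \<eta>) ^ k" using \<eta>0 by simp
    show ?thesis
    proof (cases "R \<inter> T = {}")
      case False
      then obtain h where "h \<in> R" "h \<in> T" by blast
      from via[OF R this] have "of_rat (list_cost d cs (sol g)) \<le> (1 + \<eta>) ^ k * service_cost (set A - R)" .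
      also have "\<dots> \<le> (1 + \<eta>) ^ k * ((1 + \<eta>) * service_cost (set A - R))"
        using k0 \<eta>0 pow by (intro mult_left_mono) (auto simp: mult_le_cancel_right1)
      finally show ?thesis by (simp add: mult_ac)
    next
      case True
      have imT: "f ` T = set (take N L)"
      proof
        show "set (take N L) \<subseteq> f ` T"
        proof
          fix y assume y: "y \<in> set (take N L)"
          then have "y \<in> f ` set A" using setL by (blast dest: in_set_takeD)
          with y show "y \<in> f ` T" by (auto simp: T_def)
        qed
      qed (auto simp: T_def)
      have "card T = card (f ` T)"
        using inj T by (intro card_image[symmetric]) (rule inj_on_subset)
      also have "\<dots> = min N (length A)"
        unfolding imT using distL lenL by (simp add: distinct_card)
      finally have cT: "card T = min N (length A)" .
      \<comment> \<open>If \<open>A\<close> had at most \<open>N\<close> facilities,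
        \<open>T\<close> would be all of \<open>A\<close> and meet \<open>R\<close>. So
        \<open>T\<close> has exactly \<open>N\<close> elements, enough for
        \<open>exchange\<close>.\<close>
      have "R \<noteq> {}" using R(2) by auto
      then have "T \<noteq> set A" using R(1) True by blast
      then have "card T < card (set A)" using T by (intro psubset_card_mono) auto
      then have cTN: "card T = N" using cT distinct_card[OF Suc.prems(1)] by auto
      have "Suc k * (2 * D + 3) \<le> l * (2 * D + 3)" using Suc.prems(4) by (intro mult_right_mono) auto
      then have cardT: "Suc k * (2 * D + 3) \<le> card T" using N cTN by linarith
      have cheap: "service_cost (set A - {g'}) \<le> service_cost (set A - {h})" if "g' \<in> T" "h \<in> R" for g' h
      proof -
        have h: "h \<in> set A" "h \<notin> T" using that R True by auto
        then have "f h \<notin> set (take N L)" "f h \<in> set L" using setL by (auto simp: T_def)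
        moreover have "set L = set (take N L) \<union> set (drop N L)"
          by (metis append_take_drop_id set_append)
        ultimately have "f h \<in> set (drop N L)" by blast
        moreover have "f g' \<in> set (take N L)" using that by (auto simp: T_def)
        moreover have "sorted (map fst (take N L @ drop N L))" using sortL by simp
        ultimately have "fst (f g') \<le> fst (f h)"
          unfolding map_append sorted_append by auto
        then show ?thesis using service_cost_f h that T by (auto simp: of_rat_less_eq)
      qed
      obtain R' where R': "R' \<subseteq> T" "card R' = Suc k"
        "service_cost (set A - R') \<le> (1 + 2 * real (Suc k) * \<delta>) * service_cost (set A - R)"
        using exchange[OF _ Suc.prems(3) T R RA True _ cheap \<delta> cardT] by auto
      have "R' \<noteq> {}" using R'(2) by auto
      then obtain h where h: "h \<in> R'" by blast
      have "of_rat (list_cost d cs (sol g)) \<le> (1 + \<eta>) ^ k * service_cost (set A - R')"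
        using via[of R' h] R' h T by blast
      also have "\<dots> \<le> (1 + \<eta>) ^ k * ((1 + \<eta>) * service_cost (set A - R))"
      proof (rule mult_left_mono[OF order.trans[OF R'(3)] pow])
        have "real (Suc k) * \<delta> \<le> real l * \<delta>"
          using Suc.prems(4) \<delta>(1) by (intro mult_right_mono) auto
        then have "1 + 2 * real (Suc k) * \<delta> \<le> 1 + \<eta>"
          unfolding \<eta>_def mult.assoc by linarith
        then show "(1 + 2 * real (Suc k) * \<delta>) * service_cost (set A - R) \<le> (1 + \<eta>) * service_cost (set A - R)"
          using k0 by (rule mult_right_mono)
      qed
      finally show ?thesis by (simp add: mult_ac)
    qed
  qed
  then show ?case using sol[OF g(1)] runs unfolding \<eta>_def
    by (intro exI[of _ "sol g"] conjI allI impI) blast+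
qed

subsection \<open>Running time\<close>

lemma main_runs:
  assumes solve: "runs_within (prog b) 8
      [nat_val l, nats F, nat_val (l * (l * (l * b))), nats cs, table d ps] (item (q, B)) T"
    and ps: "set cs \<times> set B \<subseteq> set ps"
  shows "\<exists>t \<le> T + ((40 * length ps + 40) * length B + 30) * length cs + 60 * l + 100.
    runs (prog b) (Node (nat_val l) (Node (nats F) (Node (nats cs) (table d ps))))
      (Node (nats B) (list_val (map (\<lambda>c. Node (nat_val c) (nat_val (snd (nearest d c B)))) cs))) t"
proof -
  let ?out = "Node (nats B) (list_val (map (\<lambda>c. Node (nat_val c) (nat_val (snd (nearest d c B)))) cs))"
  let ?x = "Node (nat_val l) (Node (nats F) (Node (nats cs) (table d ps)))"
  \<comment> \<open>Two less than the final 100: the outermost \<open>Call\<close> and its argument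
    take one step each.\<close>
  let ?T = "T + ((40 * length ps + 40) * length B + 30) * length cs + 60 * l + 98"
  obtain t1 where t1: "t1 \<le> 20 * l + 10"
    "fn (prog b) 9 [nat_val l, nat_val b] (nat_val (l * b)) t1"
    by (rule runs_withinE[OF mult_runs[of b l "b"]])
  obtain t2 where t2: "t2 \<le> 20 * l + 10"
    "fn (prog b) 9 [nat_val l, nat_val (l * b)] (nat_val (l * (l * b))) t2"
    by (rule runs_withinE[OF mult_runs[of b l "l * b"]])
  obtain t3 where t3: "t3 \<le> 20 * l + 10"
    "fn (prog b) 9 [nat_val l, nat_val (l * (l * b))] (nat_val (l * (l * (l * b)))) t3"
    by (rule runs_withinE[OF mult_runs[of b l "l * (l * b)"]])
  obtain t4 where t4: "t4 \<le> T" "fn (prog b) 8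
      [nat_val l, nats F, nat_val (l * (l * (l * b))), nats cs, table d ps] (item (q, B)) t4"
    using solve by (rule runs_withinE)
  obtain t5 where t5: "t5 \<le> ((40 * length ps + 40) * length B + 30) * length cs + 10"
    "fn (prog b) 10 [nats cs, nats B, table d ps]
     (list_val (map (\<lambda>c. Node (nat_val c) (nat_val (snd (nearest d c B)))) cs)) t5"
    by (rule runs_withinE[OF assign_runs[OF ps, of b d]])
  have main: "runs_within (prog b) 0 [?x] ?out ?T"
    using t1(1) t2(1) t3(1) t4(1) t5(1)
      t1(2)[unfolded nat_val_def] t2(2)[unfolded nat_val_def] t3(2)[unfolded nat_val_def]
      t4(2)[unfolded nat_val_def item_def] t5(2)[unfolded nat_val_def]
    by (intro runs_withinI, subst call_unfold)
      (simp add: exec_simps main_body_def nat_val_def call_eq)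
  then obtain t where t: "t \<le> ?T" "fn (prog b) 0 [?x] ?out t" by (rule runs_withinE)
  have "eval (prog b) [?x] (Call 0 [Var 0]) ?out (1 + (1 + 0) + t)"
  proof (rule eval_evals.Call)
    have "eval (prog b) [?x] (Var 0) ([?x] ! 0) 1" by (rule eval_evals.Var) simp
    then have "eval (prog b) [?x] (Var 0) ?x 1" by simp
    then show "evals (prog b) [?x] [Var 0] [?x] (1 + 0)"
      by (rule eval_evals.Cons) (rule eval_evals.Nil)
  qed (use t(2) in \<open>auto simp: fn_def\<close>)
  then show ?thesis using t(1) unfolding runs_def by (intro exI[of _ "1 + (1 + 0) + t"]) auto
qed

lemma length_le_val_size: "length vs \<le> val_size (list_val vs)"
  by (induction vs) auto

text \<open>The encoding holds one entry per ordered pair of points, so even the quadratic length of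
  the distance table is at most the instance size.\<close>

lemma instance_size_bounds:
  "card (facilities I) + card (clients I) + (card (points I))\<^sup>2 + 1 \<le> instance_size I"
proof -
  have "card X \<le> val_size (set_val X)" for X
    unfolding set_val_def by (rule order.trans[OF _ length_le_val_size]) simp
  moreover have "(card (points I))\<^sup>2 \<le> val_size (dist_val I)"
    unfolding dist_val_def Let_def
    by (rule order.trans[OF _ length_le_val_size]) (simp add: power2_eq_square)
  ultimately have "card (facilities I) + card (clients I) + (card (points I))\<^sup>2
      \<le> val_size (set_val (facilities I)) + val_size (set_val (clients I)) + val_size (dist_val I)"
    by (meson add_mono)
  then show ?thesis by (simp add: instance_size_def instance_val_def)
qed

lemma real_nat_ceiling_le: "0 \<le> x \<Longrightarrow> real (nat \<lceil>x\<rceil>) \<le> x + 1"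
  by linarith

text \<open>The halved exponent leaves room for the quadratic term: \<open>exp (e / 2)\<close> is at
  most 1 + e/2 + (e/2)^2, and (e/2)^2 is at most e/2.\<close>

lemma one_plus_power_le:
  assumes "0 \<le> e" "e \<le> 1" shows "(1 + e / (2 * real l)) ^ l \<le> 1 + e"
proof (cases "l = 0")
  case False
  have "(1 + e / (2 * real l)) ^ l = (1 + (e / 2) / real l) ^ l" by simp
  also have "\<dots> \<le> exp (e / 2)"
    using False assms by (intro exp_ge_one_plus_x_over_n_power_n) auto
  also have "\<dots> \<le> 1 + e / 2 + (e / 2)\<^sup>2" using assms by (intro exp_bound) auto
  also have "(e / 2)\<^sup>2 \<le> e / 2"
    unfolding power2_eq_square using assms by (intro mult_left_le) auto
  finally show ?thesis by simp
qed (use assms in simp)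

text \<open>With \<open>x\<close> the argument of the logarithm, the width plus one is at most
  \<open>16 * x ^ 3\<close>. Since \<open>x\<close> is at least 2, the constant is absorbed as
  \<open>x ^ 4\<close>, whence the 7.\<close>

lemma branching_le:
  assumes "0 < e" "e \<le> 1" "real b \<le> 13 / e + 1"
  shows "real (l * (l * (l * b)) + 1) ^ l \<le> 2 powr (7 * (real l * log 2 (max 2 (real l / e))))"
proof (cases "l = 0")
  case False
  define x where "x = max 2 (real l / e)"
  have l: "1 \<le> real l" using False by simp
  have x: "2 \<le> x" "real l / e \<le> x" by (auto simp: x_def)
  have l3: "real l ^ 3 / e \<le> x ^ 3"
  proof -
    have "1 / e \<le> (1 / e) ^ 3" using assms by (intro self_le_power) auto
    then have "real l ^ 3 * (1 / e) \<le> real l ^ 3 * (1 / e) ^ 3" by (intro mult_left_mono) auto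
    also have "\<dots> = (real l / e) ^ 3" by (simp add: power_divide)
    also have "\<dots> \<le> x ^ 3" using assms x by (intro power_mono) auto
    finally show ?thesis by simp
  qed
  have "real (l * (l * (l * b)) + 1) = real l ^ 3 * real b + 1"
    by (simp add: power3_eq_cube)
  also have "\<dots> \<le> real l ^ 3 * (13 / e + 1) + 1"
    using assms(3) by (intro add_mono mult_left_mono) auto
  also have "\<dots> = 13 * (real l ^ 3 / e) + real l ^ 3 + 1" by (simp add: algebra_simps)
  also have "\<dots> \<le> 16 * x ^ 3"
  proof -
    have "real l ^ 3 \<le> real l ^ 3 / e"
      using assms(1,2) by (simp add: le_divide_eq mult_left_le)
    moreover have "1 \<le> real l ^ 3" using l by (rule one_le_power)
    ultimately show ?thesis using l3 by linarith
  qed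
  also have "\<dots> = 2 ^ 4 * x ^ 3" by simp
  also have "\<dots> \<le> x ^ 4 * x ^ 3"
    using x(1) by (intro mult_right_mono power_mono) auto
  also have "\<dots> = x ^ 7" by (simp flip: power_add)
  finally have "real (l * (l * (l * b)) + 1) ^ l \<le> (x ^ 7) ^ l"
    by (intro power_mono) auto
  also have "\<dots> = x ^ (7 * l)" by (rule power_mult[symmetric])
  also have "\<dots> = x powr real (7 * l)" using x(1) by (intro powr_realpow[symmetric]) simp
  also have "\<dots> = (2 powr log 2 x) powr real (7 * l)" using x(1) by simp
  also have "\<dots> = 2 powr (7 * (real l * log 2 x))" by (simp add: powr_powr mult_ac)
  finally show ?thesis unfolding x_def .
qed simp

text \<open>\<open>S\<close>, which bounds one evaluation of the service cost, is cubic in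
  \<open>n\<close>; a node of the search tree makes up to \<open>m\<close> such evaluations, so
  \<open>\<alpha>\<close> is quartic.\<close>

lemma polynomial_bound:
  fixes p m c l n X :: nat
  assumes "p \<le> n" "m \<le> n" "c \<le> n" "l \<le> n" "1 \<le> n" "m' \<le> m" "1 \<le> X"
    and S: "S = ((40 * p + 40) * m + 30) * c"
    and \<alpha>: "\<alpha> = (S + 60 * m + 100) * m + S + 60"
    and T: "T + 40 \<le> (\<alpha> + 40) * X"
  shows "T + ((40 * p + 40) * m' + 30) * c + 60 * l + 100 \<le> 1000 * n ^ 4 * X"
proof -
  have pow: "n \<le> n ^ 4" "n ^ 2 \<le> n ^ 4" "n ^ 3 \<le> n ^ 4" "1 \<le> n ^ 4"
    using assms(5) by (simp_all add: power_increasing self_le_power)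
  have "(40 * p + 40) * m' + 30 \<le> (80 * n) * n + 30 * n"
    using assms by (intro add_mono mult_mono) auto
  then have S': "((40 * p + 40) * m' + 30) * c \<le> ((80 * n) * n + 30 * n) * n"
    using assms(3) by (intro mult_mono) auto
  have "(40 * p + 40) * m + 30 \<le> (80 * n) * n + 30 * n"
    using assms by (intro add_mono mult_mono) auto
  then have S_le: "S \<le> ((80 * n) * n + 30 * n) * n"
    unfolding S using assms(3) by (intro mult_mono) auto
  have S3: "((80 * n) * n + 30 * n) * n \<le> 110 * n ^ 3"
    using power_increasing[of 2 3 n] assms(5)
    by (simp add: power2_eq_square power3_eq_cube algebra_simps)
  have "S + 60 * m + 100 \<le> 110 * n ^ 3 + 60 * n ^ 3 + 100 * n ^ 3"
    using S_le S3 assms(2,5) self_le_power[of n 3] one_le_power[of n 3] by linarith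
  then have "(S + 60 * m + 100) * m \<le> (270 * n ^ 3) * n"
    using assms(2) by (intro mult_mono) auto
  also have "\<dots> = 270 * n ^ 4" by (simp add: power4_eq_xxxx power3_eq_cube)
  finally have "\<alpha> + 40 \<le> 480 * n ^ 4" using S_le S3 pow unfolding \<alpha> by linarith
  then have "(\<alpha> + 40) * X \<le> 480 * n ^ 4 * X" by (intro mult_right_mono) auto
  moreover have "((40 * p + 40) * m' + 30) * c + 60 * l + 100 \<le> 270 * n ^ 4 * X"
  proof -
    have "((40 * p + 40) * m' + 30) * c + 60 * l + 100 \<le> 270 * n ^ 4"
      using S' S3 pow assms(4) by linarith
    also have "\<dots> \<le> 270 * n ^ 4 * X" using assms(7) by simp
    finally show ?thesis .
  qed
  moreover have "480 * n ^ 4 * X + 270 * n ^ 4 * X \<le> 1000 * n ^ 4 * X" by simp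
  ultimately show ?thesis using T by linarith
qed

lemma finite_metric_instance:
  assumes "valid_instance I"
  shows "finite_metric (points I) (set (sorted_list_of_set (clients I))) (\<lambda>x y. of_rat (dist_fun I x y))"
  using assms unfolding valid_instance_def finite_metric_def
  by (auto simp: points_def of_rat_less_eq simp flip: of_rat_add)

section \<open>Choice of the constants and assembly of the guarantee\<close>

theorem theorem1:
  "\<exists>K::nat. \<forall>\<epsilon>::real. \<epsilon> > 0 \<longrightarrow>
     (\<exists>P::program. \<forall>I::co_median. valid_instance I \<and> (\<exists>s. feasible I s) \<longrightarrow>
        (\<exists>s t. runs P (instance_val I) (solution_val I s) t \<and>
           feasible I s \<and> cost I s \<le> (1 + \<epsilon>) * opt I \<and>
           real t \<le> 2 powr (real K * time_exponent (param I) \<epsilon>)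
                      * (real K * real (instance_size I) ^ K)))"
\<comment> \<open>The exponents actually reached are 7 and 4; 1000 is the constant factor of
  \<open>polynomial_bound\<close>, and one \<open>K\<close> has to serve for all three.\<close>
proof (intro exI[of _ 1000] allI impI)
  fix \<epsilon> :: real
  assume "\<epsilon> > 0"
  define e where "e = min 1 \<epsilon>"
  have e: "0 < e" "e \<le> 1" "e \<le> \<epsilon>" using \<open>\<epsilon> > 0\<close> by (auto simp: e_def)
  \<comment> \<open>For positive l and the \<open>D\<close> below, \<open>2 * D + 3\<close> is at
    most 8 l^2 / e + 5, hence at most 13 l^2 / e.\<close>
  define b where "b = nat \<lceil>13 / e\<rceil>"
  have b: "13 / e \<le> real b" "real b \<le> 13 / e + 1"
    using e unfolding b_def by (auto intro: real_nat_ceiling_ge real_nat_ceiling_le)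
  show "\<exists>P::program. \<forall>I::co_median. valid_instance I \<and> (\<exists>s. feasible I s) \<longrightarrow>
        (\<exists>s t. runs P (instance_val I) (solution_val I s) t \<and>
           feasible I s \<and> cost I s \<le> (1 + \<epsilon>) * opt I \<and>
           real t \<le> 2 powr (real 1000 * time_exponent (param I) \<epsilon>)
                      * (real 1000 * real (instance_size I) ^ 1000))"
  proof (intro exI[of _ "prog b"] allI impI, elim conjE)
    fix I :: co_median
    assume valid: "valid_instance I" and ex: "\<exists>s. feasible I s"
    define d where "d = dist_fun I"
    define l where "l = param I"
    define F where "F = sorted_list_of_set (facilities I)"
    define cs where "cs = sorted_list_of_set (clients I)"
    define ps where "ps = (let xs = sorted_list_of_set (points I) in List.product xs xs)"
    have fin: "finite (facilities I)" "finite (clients I)" "finite (points I)"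
      using valid by (auto simp: valid_instance_def points_def)
    have F: "set F = facilities I" "distinct F" "sorted F" "length F = card (facilities I)"
      using fin by (auto simp: F_def)
    have cs: "set cs = clients I" "distinct cs" "length cs = card (clients I)"
      using fin by (auto simp: cs_def)
    have ps: "set ps = points I \<times> points I" "length ps = (card (points I))\<^sup>2"
      using fin by (auto simp: ps_def Let_def power2_eq_square)
    have metric: "finite_metric (points I) (set cs) (\<lambda>x y. of_rat (d x y))"
      using finite_metric_instance[OF valid] by (simp add: cs_def d_def)
    interpret finite_metric "points I" "set cs" "\<lambda>x y. of_rat (d x y)" by (rule metric)
    have input: "instance_val I = Node (nat_val l) (Node (nats F) (Node (nats cs) (table d ps)))"
      by (simp add: instance_val_def l_def F_def cs_def ps_def set_val_def nats_def dist_val_def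
          table_def d_def Let_def)
    from ex obtain A0 \<phi>0 where A0: "A0 \<subseteq> facilities I" "card A0 + l \<le> length F"
      "\<forall>c\<in>clients I. \<phi>0 c \<in> A0" by (auto simp: feasible_def l_def F)
    have lF: "l < length F \<or> cs = [] \<and> l \<le> length F"
    proof (cases "cs = []")
      case False
      then have "A0 \<noteq> {}" using A0(3) cs(1) by (cases cs) auto
      then have "0 < card A0" using A0(1) fin(1) by (meson card_gt_0_iff finite_subset)
      then show ?thesis using A0(2) by linarith
    qed (use A0(2) in simp)
    \<comment> \<open>The maximum keeps \<open>\<delta>\<close> positive for l = 0; otherwise
      \<open>2 * real l * \<delta>\<close> becomes e / (2 l), as \<open>one_plus_power_le\<close>
      requires.\<close>
    define l' where "l' = max 1 (real l)"
    define \<delta> where "\<delta> = e / (4 * l'\<^sup>2)"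
    define D where "D = nat \<lceil>4 * l'\<^sup>2 / e\<rceil>"
    define N where "N = l * (l * (l * b))"
    have l': "1 \<le> l'" by (simp add: l'_def)
    have \<delta>: "0 < \<delta>" "1 \<le> \<delta> * real D"
    proof -
      show "0 < \<delta>" using e l' by (simp add: \<delta>_def)
      have "\<delta> * (4 * l'\<^sup>2 / e) \<le> \<delta> * real D"
        unfolding D_def using \<open>0 < \<delta>\<close> by (intro mult_left_mono real_nat_ceiling_ge) auto
      then show "1 \<le> \<delta> * real D" using e l' by (simp add: \<delta>_def)
    qed
    have N: "l * (2 * D + 3) \<le> N"
    proof (cases "l = 0")
      case False
      then have l'l: "l' = real l" by (simp add: l'_def)
      have ge: "1 \<le> (real l)\<^sup>2 / e"
      proof -
        have "1 \<le> (real l)\<^sup>2" using False by (intro one_le_power) simp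
        with e show ?thesis by (simp add: le_divide_eq)
      qed
      have "real D \<le> 4 * ((real l)\<^sup>2 / e) + 1"
        unfolding D_def l'l using real_nat_ceiling_le[of "4 * (real l)\<^sup>2 / e"] e by simp
      then have "real (2 * D + 3) \<le> 13 * ((real l)\<^sup>2 / e)" using ge by simp
      also have "\<dots> = (real l)\<^sup>2 * (13 / e)" by simp
      also have "\<dots> \<le> (real l)\<^sup>2 * real b" using b(1) by (intro mult_left_mono) auto
      also have "\<dots> = real (l * (l * b))" by (simp add: power2_eq_square)
      finally have "2 * D + 3 \<le> l * (l * b)" by (simp only: of_nat_le_iff)
      then show ?thesis unfolding N_def by (rule mult_left_mono) simp
    qed simp
    define S where "S = ((40 * length ps + 40) * length F + 30) * length cs"
    define \<alpha> where "\<alpha> = (S + 60 * length F + 100) * length F + S + 60"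
    have "set F \<subseteq> points I" "set cs \<times> points I \<subseteq> set ps"
      using F cs ps by (auto simp: points_def)
    from solve_runs[OF metric cs(2) this(2) \<delta> N S_def \<alpha>_def F(2,3) this(1) order.refl order.refl lF, of b]
    obtain B where B: "set B \<subseteq> set F" "distinct B" "sorted B" "length B + l = length F"
      and approx: "\<And>R. R \<subseteq> set F \<Longrightarrow> card R = l \<Longrightarrow>
        of_rat (list_cost d cs B) \<le> (1 + 2 * real l * \<delta>) ^ l * service_cost (set F - R)"
      and solve: "runs_within (prog b) 8 [nat_val l, nats F, nat_val N, nats cs, table d ps]
        (item (list_cost d cs B, B)) (solve_time \<alpha> N l)"
      by auto
    define \<phi> where "\<phi> c = snd (nearest d c B)" for c
    have Bne: "B \<noteq> [] \<or> cs = []" using B(4) lF by auto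
    have near: "\<phi> c \<in> set B \<and> d c (\<phi> c) = fst (nearest d c B)" if "c \<in> clients I" for c
      using nearest_correct[of B d c] Bne that cs(1) by (auto simp: \<phi>_def)
    have feas: "feasible I (set B, \<phi>)"
      using B F(1,4) near distinct_card[OF B(2)] by (auto simp: feasible_def l_def)
    have cost_eq: "cost I (set B, \<phi>) = of_rat (list_cost d cs B)"
    proof -
      have "cost I (set B, \<phi>) = (\<Sum>c\<in>set cs. of_rat (fst (nearest d c B)))"
        unfolding cost_def using cs(1) near by (simp add: d_def)
      then show ?thesis
        using cs(2) by (simp add: list_cost_def of_rat_sum sum_list_distinct_conv_sum_set)
    qed
    have factor: "(1 + 2 * real l * \<delta>) ^ l \<le> 1 + e"
    proof (cases "l = 0")
      case False
      then have "2 * real l * \<delta> = e / (2 * real l)"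
        by (simp add: \<delta>_def l'_def power2_eq_square field_simps)
      then show ?thesis using one_plus_power_le[of e l] e by simp
    qed (use e in simp)
    have le: "cost I (set B, \<phi>) \<le> (1 + \<epsilon>) * cost I s" if s: "feasible I s" for s
    proof (cases "cs = []")
      case True
      then have "clients I = {}" using cs(1) by simp
      then show ?thesis by (simp add: cost_def split: prod.split)
    next
      case False
      obtain A \<psi> where [simp]: "s = (A, \<psi>)" by (cases s)
      have A: "A \<subseteq> set F" "card A + l \<le> length F" "\<forall>c\<in>set cs. \<psi> c \<in> A"
        using s F cs by (auto simp: feasible_def l_def)
      have finA: "finite A" using A(1) finite_subset by blast
      have "A \<noteq> {}" using False A(3) by (cases cs) auto
      \<comment> \<open>A solution may close more than \<open>l\<close> facilities. Comparing with
        just \<open>l\<close> of them closed is sound, since reopening the others does not raise the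
        service cost.\<close>
      have "card (set F - A) = length F - card A"
        using A(1) finA F(2) by (simp add: card_Diff_subset distinct_card)
      then have "l \<le> card (set F - A)" using A(2) by linarith
      then obtain R where R: "R \<subseteq> set F - A" "card R = l" by (rule obtain_subset_with_card_n)
      have sub: "A \<subseteq> set F - R" using A R by blast
      have ne: "set F - R \<noteq> {}" using sub \<open>A \<noteq> {}\<close> by blast
      have "service_cost (set F - R) \<le> service_cost A" using sub \<open>A \<noteq> {}\<close> by (intro service_cost_antimono) auto
      also have "\<dots> \<le> cost I s"
        unfolding service_cost_def cost_def using A finA cs(1)
        by (auto intro!: sum_mono serve_le simp flip: d_def)
      finally have le1: "service_cost (set F - R) \<le> cost I s" .
      have nonneg: "0 \<le> service_cost (set F - R)"
        using ne \<open>set F \<subseteq> points I\<close> by (intro service_cost_nonneg) auto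
      have "cost I (set B, \<phi>) \<le> (1 + 2 * real l * \<delta>) ^ l * service_cost (set F - R)"
        unfolding cost_eq using approx R by blast
      also have "\<dots> \<le> (1 + \<epsilon>) * service_cost (set F - R)"
        using factor e nonneg by (intro mult_right_mono) auto
      also have "\<dots> \<le> (1 + \<epsilon>) * cost I s" using le1 \<open>\<epsilon> > 0\<close> by (intro mult_left_mono) auto
      finally show ?thesis .
    qed
    \<comment> \<open>\<open>opt\<close> is an infimum; dividing first gives a lower bound on all
      feasible costs, so no optimal solution has to be exhibited.\<close>
    have "cost I (set B, \<phi>) / (1 + \<epsilon>) \<le> opt I"
      unfolding opt_def using feas le \<open>\<epsilon> > 0\<close>
      by (intro cINF_greatest) (auto simp: divide_le_eq mult.commute)
    then have opt: "cost I (set B, \<phi>) \<le> (1 + \<epsilon>) * opt I"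
      using \<open>\<epsilon> > 0\<close> by (simp add: divide_le_eq mult.commute)
    have "set cs \<times> set B \<subseteq> set ps" using B(1) F cs ps by (auto simp: points_def)
    from main_runs[OF solve[unfolded N_def] this] obtain t where
      t: "t \<le> solve_time \<alpha> N l + ((40 * length ps + 40) * length B + 30) * length cs + 60 * l + 100"
      and run: "runs (prog b) (instance_val I)
        (Node (nats B) (list_val (map (\<lambda>c. Node (nat_val c) (nat_val (\<phi> c))) cs))) t"
      unfolding input \<phi>_def N_def by blast
    have out_eq: "Node (nats B) (list_val (map (\<lambda>c. Node (nat_val c) (nat_val (\<phi> c))) cs))
        = solution_val I (set B, \<phi>)"
      using B(2,3) by (simp add: solution_val_def set_val_def nats_def cs_def
          sorted_list_of_set.idem_if_sorted_distinct)
    define n where "n = instance_size I"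
    have n: "length ps \<le> n" "length F \<le> n" "length cs \<le> n" "l \<le> n" "1 \<le> n"
      using instance_size_bounds[of I] F(4) cs(3) ps(2) B(4) unfolding n_def by linarith+
    have "t \<le> 1000 * n ^ 4 * (N + 1) ^ l"
      using t polynomial_bound[OF n _ _ S_def \<alpha>_def solve_time_le, of "length B" N l] B(4)
      by (auto intro: order.trans)
    then have "real t \<le> real (1000 * n ^ 4 * (N + 1) ^ l)" by (rule of_nat_mono)
    also have "\<dots> = real (N + 1) ^ l * (1000 * real n ^ 4)" by simp
    also have "\<dots> \<le> 2 powr (real 1000 * time_exponent l \<epsilon>) * (real 1000 * real n ^ 1000)"
    proof (intro mult_mono)
      have "0 \<le> time_exponent l \<epsilon>" by (simp add: time_exponent_def)
      then have "2 powr (7 * time_exponent l \<epsilon>) \<le> 2 powr (real 1000 * time_exponent l \<epsilon>)" by simp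
      moreover have "real (N + 1) ^ l \<le> 2 powr (7 * time_exponent l \<epsilon>)"
        unfolding N_def time_exponent_def e_def[symmetric] by (rule branching_le[OF e(1,2) b(2)])
      ultimately show "real (N + 1) ^ l \<le> 2 powr (real 1000 * time_exponent l \<epsilon>)" by linarith
      show "real n ^ 4 \<le> real n ^ 1000" using n(5) by (intro power_increasing) auto
    qed auto
    finally have "real t \<le> 2 powr (real 1000 * time_exponent (param I) \<epsilon>)
        * (real 1000 * real (instance_size I) ^ 1000)"
      unfolding l_def n_def .
    then show "\<exists>s t. runs (prog b) (instance_val I) (solution_val I s) t \<and>
           feasible I s \<and> cost I s \<le> (1 + \<epsilon>) * opt I \<and>
           real t \<le> 2 powr (real 1000 * time_exponent (param I) \<epsilon>)
                      * (real 1000 * real (instance_size I) ^ 1000)"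
      using run[unfolded out_eq] feas opt by blast
  qed
qed

end
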